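(* Let $\Phi=\{\phi^t\}_{t\in\mathbb{R}}$ be a continuous flow on a compact metric space $X$ satisfying the almost specification property, and let $\varphi:X\to\mathbb{R}$ be a continuous function. If $\hat X(\Phi,\varphi)$ is not empty, then $$h(\Phi,\hat X(\Phi,\varphi))=h(\Phi).$$
   Context: A continuous flow on a compact metric space $(X,d)$ is a continuous map $\Phi:\mathbb{R}\times X\to X$, $\phi^t(x)=\Phi(t,x)$, with $\phi^0=\mathrm{id}$ and $\phi^{s+t}=\phi^s\circ\phi^t$. $h(\Phi):=h(\phi^1)$ is the usual (Bowen–Dinaburg, spanning set) topological entropy of the time-one map. $\hat X(\Phi,\varphi)$ is the set of $\varphi$-irregular points of $\Phi$: those $x\in X$ for which $\frac1T\int_0^T\varphi(\phi^t(x))\,dt$ does not converge as $T\to\infty$. Almost specification property for flows. A mistake function is a function $g:\mathbb{R}^+\times(0,\varepsilon_0]\to\mathbb{R}^+$ (for some fixed $\varepsilon_0>0$; $\mathbb{R}^+$ the positive reals) such that for every $\varepsilon\in(0,\varepsilon_0]$, $g(\cdot,\varepsilon)$ is continuous and nondecreasing and $\lim_{t\to\infty}g(t,\varepsilon)/t=0$; it is extended by $g(t,\varepsilon):=g(t,\varepsilon_0)$ for $\varepsilon>\varepsilon_0$. For $T>0$ let $B^\Phi_T(g|x,\varepsilon)$ be the set of $y\in X$ for which there is a Lebesgue measurable $\Lambda\subseteq[0,T]$ with $\lambda([0,T]\setminus\Lambda)\le g(T,\varepsilon)$ ($\lambda$ Lebesgue measure) and $\sup_{t\in\Lambda}d(\phi^tx,\phi^ty)<\varepsilon$.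 $\Phi$ has the almost specification property if there is a mistake function $g$ such that for any positive integer $k$ and any $\varepsilon_1,\dots,\varepsilon_k>0$ there are positive numbers $T_g(\varepsilon_1),\dots,T_g(\varepsilon_k)$ such that for all $x_1,\dots,x_k\in X$ and times $t_i\ge T_g(\varepsilon_i)$, $i=1,\dots,k$, there is $z\in X$ with $\phi^{T_j}(z)\in B^\Phi_{t_j}(g|x_j,\varepsilon_j)$ for all $j=1,\dots,k$, where $t_0=0$ and $T_j=t_0+t_1+\dots+t_{j-1}$. Topological entropy of a flow on a subset $Y\subseteq X$. Let $\mathcal U$ be a finite open cover of $X$. For $B\subseteq X$ write $B\prec\mathcal U$ if $B$ is contained in some element of $\mathcal U$. Let $N(B)$ be the largest nonnegative number such that $\phi^t(B)\prec\mathcal U$ for all $0\le t<N(B)$, with $N(B)=0$ if $B\not\prec\mathcal U$ and $N(B)=\infty$ if $\phi^t(B)\prec\mathcal U$ for all $t\ge0$. Put $D(B)=e^{-N(B)}$ if $N(B)<\infty$ and $D(B)=0$ if $N(B)=\infty$. For $\alpha>0$ and a countable collection $\mathcal B=\{B_i\}_{i\ge1}$ put $S_\alpha(\mathcal B)=\sum_{i\ge1}D(B_i)^\alpha$. Put $\Gamma_\alpha(Y)=\lim_{\varepsilon\to0}\inf\{S_\alpha(\mathcal E):\mathcal E=\{E_i\}_{i\ge1}\text{ a countable cover of }Y\text{ with }D(E_i)<\varepsilon\text{ for all }i\}$, $h_{\mathcal U}(\Phi,Y)=\inf\{\alpha>0:\Gamma_\alpha(Y)=0\}$ (with $\inf\emptyset=\infty$),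 and $h(\Phi,Y)=\sup_{\mathcal U}h_{\mathcal U}(\Phi,Y)$ over finite open covers $\mathcal U$ of $X$. *)

theory Defs
  imports "HOL-Analysis.Analysis"
begin

definition continuous_flow :: "(real \<Rightarrow> 'a::metric_space \<Rightarrow> 'a) \<Rightarrow> bool" where
  "continuous_flow \<Phi> \<longleftrightarrow>
     continuous_on UNIV (\<lambda>(t, x). \<Phi> t x) \<and> \<Phi> 0 = id \<and> (\<forall>s t. \<Phi> (s + t) = \<Phi> s \<circ> \<Phi> t)"

definition irregular_points ::
    "(real \<Rightarrow> 'a::metric_space \<Rightarrow> 'a) \<Rightarrow> ('a \<Rightarrow> real) \<Rightarrow> 'a set" where
  "irregular_points \<Phi> f =
     {x. \<not> (\<exists>L. ((\<lambda>T. (1 / T) * integral {0..T} (\<lambda>t. f (\<Phi> t x))) \<longlongrightarrow> L) at_top)}"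


subsection \<open>Almost specification\<close>

text \<open>A mistake function is represented by a total function whose values matter only for
  a positive first argument and a second argument in the interval from 0 (excluded) to
  the cutoff e0; \<open>mistake_ext\<close> is its extension to all positive second arguments.\<close>

definition mistake_function :: "real \<Rightarrow> (real \<Rightarrow> real \<Rightarrow> real) \<Rightarrow> bool" where
  "mistake_function e0 g \<longleftrightarrow>
     e0 > 0 \<and>
     (\<forall>e\<in>{0<..e0}.
        (\<forall>t>0. g t e > 0) \<and>
        continuous_on {0<..} (\<lambda>t. g t e) \<and>
        mono_on {0<..} (\<lambda>t. g t e) \<and>
        ((\<lambda>t. g t e / t) \<longlongrightarrow> 0) at_top)"

definition mistake_ext :: "real \<Rightarrow> (real \<Rightarrow> real \<Rightarrow> real) \<Rightarrow> real \<Rightarrow> real \<Rightarrow> real" where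
  "mistake_ext e0 g t e = (if e \<le> e0 then g t e else g t e0)"

text \<open>The supremum is taken in the extended reals, so that the condition is vacuous
  when \<open>\<Lambda>\<close> is empty.\<close>

definition mistake_ball ::
    "(real \<Rightarrow> 'a::metric_space \<Rightarrow> 'a) \<Rightarrow> (real \<Rightarrow> real \<Rightarrow> real) \<Rightarrow> real \<Rightarrow> 'a \<Rightarrow> real \<Rightarrow> 'a set" where
  "mistake_ball \<Phi> g T x e =
     {y. \<exists>\<Lambda>. \<Lambda> \<in> sets lebesgue \<and> \<Lambda> \<subseteq> {0..T} \<and>
             measure lebesgue ({0..T} - \<Lambda>) \<le> g T e \<and>
             (SUP t\<in>\<Lambda>. ereal (dist (\<Phi> t x) (\<Phi> t y))) < ereal e}"

text \<open>The threshold \<open>Tg\<close> depends on the mistake function and on the scale only, not on the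
  number of orbit segments or on the other scales.\<close>

definition almost_specification :: "(real \<Rightarrow> 'a::metric_space \<Rightarrow> 'a) \<Rightarrow> bool" where
  "almost_specification \<Phi> \<longleftrightarrow>
     (\<exists>e0 g. mistake_function e0 g \<and>
       (\<exists>Tg :: real \<Rightarrow> real. (\<forall>e>0. Tg e > 0) \<and>
         (\<forall>k::nat. \<forall>e :: nat \<Rightarrow> real. k \<ge> 1 \<and> (\<forall>i\<in>{1..k}. e i > 0) \<longrightarrow>
           (\<forall>(x :: nat \<Rightarrow> 'a) (t :: nat \<Rightarrow> real).
              (\<forall>i\<in>{1..k}. t i \<ge> Tg (e i)) \<longrightarrow>
              (\<exists>z. \<forall>j\<in>{1..k}.
                 \<Phi> (\<Sum>i=1..<j. t i) z \<in> mistake_ball \<Phi> (mistake_ext e0 g) (t j) (x j) (e j))))))"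


subsection \<open>Topological entropy\<close>

definition spanning :: "('a::metric_space \<Rightarrow> 'a) \<Rightarrow> nat \<Rightarrow> real \<Rightarrow> 'a set \<Rightarrow> bool" where
  "spanning f n e E \<longleftrightarrow> (\<forall>x. \<exists>y\<in>E. \<forall>i<n. dist ((f ^^ i) x) ((f ^^ i) y) \<le> e)"

definition spanning_number :: "('a::metric_space \<Rightarrow> 'a) \<Rightarrow> nat \<Rightarrow> real \<Rightarrow> nat" where
  "spanning_number f n e = (INF E \<in> {E. finite E \<and> spanning f n e E}. card E)"

definition topological_entropy :: "('a::metric_space \<Rightarrow> 'a) \<Rightarrow> ereal" where
  "topological_entropy f =
     Lim (at_right 0) (\<lambda>e. limsup (\<lambda>n. ereal (ln (real (spanning_number f n e)) / real n)))"

definition flow_entropy :: "(real \<Rightarrow> 'a::metric_space \<Rightarrow> 'a) \<Rightarrow> ereal" where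
  "flow_entropy \<Phi> = topological_entropy (\<Phi> 1)"


subsection \<open>Entropy of a flow on a subset\<close>

definition finite_open_cover :: "'a::topological_space set set \<Rightarrow> bool" where
  "finite_open_cover \<U> \<longleftrightarrow> finite \<U> \<and> (\<forall>U\<in>\<U>. open U) \<and> \<Union>\<U> = UNIV"

definition subordinate :: "'a set \<Rightarrow> 'a set set \<Rightarrow> bool" where
  "subordinate B \<U> \<longleftrightarrow> (\<exists>U\<in>\<U>. B \<subseteq> U)"

text \<open>The set of admissible \<open>s\<close> contains its supremum, which is 0 if \<open>B\<close> is not subordinate
  to the cover and \<open>\<infinity>\<close> if all forward images of \<open>B\<close> are.\<close>

definition cover_time ::
    "(real \<Rightarrow> 'a \<Rightarrow> 'a) \<Rightarrow> 'a set set \<Rightarrow> 'a set \<Rightarrow> ereal" where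
  "cover_time \<Phi> \<U> B =
     Sup {s. 0 \<le> s \<and> (\<forall>t. 0 \<le> t \<and> ereal t < s \<longrightarrow> subordinate (\<Phi> t ` B) \<U>)}"

definition cover_diam ::
    "(real \<Rightarrow> 'a \<Rightarrow> 'a) \<Rightarrow> 'a set set \<Rightarrow> 'a set \<Rightarrow> real" where
  "cover_diam \<Phi> \<U> B =
     (if cover_time \<Phi> \<U> B = \<infinity> then 0 else exp (- real_of_ereal (cover_time \<Phi> \<U> B)))"

definition cover_sum ::
    "(real \<Rightarrow> 'a \<Rightarrow> 'a) \<Rightarrow> 'a set set \<Rightarrow> real \<Rightarrow> (nat \<Rightarrow> 'a set) \<Rightarrow> ennreal" where
  "cover_sum \<Phi> \<U> \<alpha> E = (\<Sum>i. ennreal (cover_diam \<Phi> \<U> (E i) powr \<alpha>))"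

text \<open>Countable covers are sequences of sets. Finite ones are included: pad them with the
  empty set, which contributes 0.\<close>

definition cover_measure ::
    "(real \<Rightarrow> 'a \<Rightarrow> 'a) \<Rightarrow> 'a set set \<Rightarrow> real \<Rightarrow> 'a set \<Rightarrow> ennreal" where
  "cover_measure \<Phi> \<U> \<alpha> Y =
     Lim (at_right 0) (\<lambda>e.
       INF E \<in> {E :: nat \<Rightarrow> 'a set. Y \<subseteq> (\<Union>i. E i) \<and> (\<forall>i. cover_diam \<Phi> \<U> (E i) < e)}.
         cover_sum \<Phi> \<U> \<alpha> E)"

definition cover_entropy ::
    "(real \<Rightarrow> 'a \<Rightarrow> 'a) \<Rightarrow> 'a set set \<Rightarrow> 'a set \<Rightarrow> ereal" where
  "cover_entropy \<Phi> \<U> Y = Inf {ereal \<alpha> |\<alpha>. \<alpha> > 0 \<and> cover_measure \<Phi> \<U> \<alpha> Y = 0}"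

definition subset_entropy ::
    "(real \<Rightarrow> 'a::metric_space \<Rightarrow> 'a) \<Rightarrow> 'a set \<Rightarrow> ereal" where
  "subset_entropy \<Phi> Y = (SUP \<U> \<in> {\<U>. finite_open_cover \<U>}. cover_entropy \<Phi> \<U> Y)"

end

theory Submission
  imports Defs
begin

text \<open>
  The upper bound holds for every subset: the Bowen balls of a spanning set have small \<open>D\<close> and cover
  the whole space, and the entropy of the flow counts them.

  For the lower bound, let \<open>\<alpha>\<close> be smaller than the entropy. Everything is reduced to the time-one map
  \<open>f\<close> and to the observable \<open>\<psi> x\<close>, the integral of \<open>\<phi>\<close> over the first unit of the orbit of \<open>x\<close>. A whole
  family of irregular points is then built, with no invariant measures involved, from three ingredients.

  \<^item> Many points that can be told apart in spite of mistakes (\<open>rich_separated_sets\<close>). For suitable large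
    \<open>n\<close> there are more than \<open>exp (\<alpha> * n)\<close> points whose orbits of length \<open>n\<close> differ visibly at a fixed
    positive proportion of the times. The reason is that a Bowen ball enlarged by tolerating a
    small proportion of mistakes is covered by few Bowen balls, with arbitrarily small exponential rate. By the pigeonhole principle their
    Birkhoff averages may be taken to be almost the same.

  \<^item> Two competing averages (\<open>gap_of_divergent_averages\<close>). An irregular point provides a number \<open>G > 0\<close>
    and, for every length \<open>r\<close>, two orbit segments of length \<open>r\<close> whose averages differ by at least \<open>G\<close>.

  \<^item> Tracing (\<open>sparse_tracing_time_one\<close>). By almost specification and compactness, any infinite sequence of
    long enough orbit segments is followed by one orbit, up to a small proportion of mistakes in each.

  Fix a single large \<open>n\<close> and take \<open>r\<close> to be a small multiple of \<open>n\<close>. A number \<open>u\<close> in \<open>[0, 1)\<close> is written in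
  base \<open>M\<close>, where \<open>M\<close> is the number of separated points. The point \<open>z u\<close> traces an infinite sequence of
  superblocks of length \<open>L = r + n\<close>: first one of the two competing segments of length \<open>r\<close>, then the orbit
  of the separated point selected by the next digit of \<open>u\<close>. The choice between the competing segments is
  constant for \<open>2 ^ k \<le> s < 2 ^ (k + 1)\<close>, where \<open>s\<close> numbers the superblocks, and alternates with \<open>k\<close>. As the
  separated points contribute almost equal sums, the averages over these dyadic windows keep oscillating,
  and \<open>z u\<close> is irregular. On the other hand, the orbit of \<open>z u\<close> up to time \<open>l * L\<close> determines \<open>l\<close> digits of \<open>u\<close>,
  that is, \<open>u\<close> up to \<open>1 / M ^ l \<le> exp (- \<alpha> * l * L)\<close>. Countable subadditivity of Lebesgue measure on
  \<open>[0, 1)\<close> therefore bounds the cover sums of the irregular set at the exponent \<open>\<alpha>\<close> from below.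
\<close>

section \<open>Entropy and spanning sets\<close>

text \<open>The limits as the scale tends to 0 in the definitions of the entropies exist by monotonicity. The lemma is
  stated for general orders since one limit is extended real and the other extended nonnegative.\<close>

lemma tendsto_SUP_at_right_0:
  fixes F :: "real \<Rightarrow> 'b::{complete_linorder, linorder_topology}"
  assumes "\<And>x y. 0 < x \<Longrightarrow> x \<le> y \<Longrightarrow> F y \<le> F x"
  shows "(F \<longlongrightarrow> (SUP x\<in>{0<..}. F x)) (at_right 0)"
proof (rule order_tendstoI)
  fix a assume "a < (SUP x\<in>{0<..}. F x)"
  then obtain x where "0 < x" "a < F x" by (auto simp: less_SUP_iff)
  then show "\<forall>\<^sub>F x in at_right 0. a < F x"
    unfolding eventually_at_right_field
    using assms by (intro exI[of _ x]) (auto intro: less_le_trans less_imp_le)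
next
  fix a assume *: "(SUP x\<in>{0<..}. F x) < a"
  have "F x < a" if "0 < x" for x
    using SUP_upper[of x "{0<..}" F] that * by (auto intro: le_less_trans)
  then show "\<forall>\<^sub>F x in at_right 0. F x < a"
    unfolding eventually_at_right_field by (intro exI[of _ 1]) auto
qed

lemma Lim_at_right_0_eq_SUP:
  fixes F :: "real \<Rightarrow> 'b::{complete_linorder, linorder_topology}"
  assumes "\<And>x y. 0 < x \<Longrightarrow> x \<le> y \<Longrightarrow> F y \<le> F x"
  shows "Lim (at_right 0) F = (SUP x\<in>{0<..}. F x)"
  using tendsto_SUP_at_right_0[OF assms] by (intro tendsto_Lim) auto

lemma continuous_on_funpow:
  fixes f :: "'a::topological_space \<Rightarrow> 'a"
  assumes "continuous_on UNIV f"
  shows "continuous_on UNIV (f ^^ n)"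
proof (induction n)
  case 0
  show ?case by (simp add: id_def)
next
  case (Suc n)
  then show ?case
    using continuous_on_compose[of UNIV "f ^^ n" f] continuous_on_subset[OF assms]
    by (simp add: o_def)
qed

lemma finite_spanning_exists:
  fixes f :: "'a::metric_space \<Rightarrow> 'a"
  assumes cpt: "compact (UNIV :: 'a set)" and f: "continuous_on UNIV f" and e: "e > 0"
  obtains E where "finite E" "spanning f n e E"
proof -
  define B where "B c = (\<Inter>i<n. {x. dist ((f ^^ i) x) ((f ^^ i) c) < e})" for c
  have "open (B c)" for c
    unfolding B_def
    using continuous_on_funpow[OF f]
    by (auto intro!: open_INT open_Collect_less continuous_on_dist continuous_on_const)
  moreover have "UNIV \<subseteq> (\<Union>c\<in>UNIV. B c)" using e by (auto simp: B_def)
  ultimately obtain E where "finite E" "UNIV \<subseteq> (\<Union>c\<in>E. B c)"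
    by (rule compactE_image[OF cpt])
  then have "spanning f n e E"
    unfolding spanning_def B_def by (fastforce intro: less_imp_le)
  with \<open>finite E\<close> show ?thesis using that by blast
qed

lemma spanning_number_le_card:
  assumes "finite E" "spanning f n e E"
  shows "spanning_number f n e \<le> card E"
  unfolding spanning_number_def using assms by (intro cINF_lower) auto

lemma spanning_number_attained:
  fixes f :: "'a::metric_space \<Rightarrow> 'a"
  assumes "compact (UNIV :: 'a set)" "continuous_on UNIV f" "e > 0"
  obtains E where "finite E" "spanning f n e E" "card E = spanning_number f n e"
proof -
  have "card ` {E. finite E \<and> spanning f n e E} \<noteq> {}"
    using finite_spanning_exists[OF assms] by blast
  then have "spanning_number f n e \<in> card ` {E. finite E \<and> spanning f n e E}"
    unfolding spanning_number_def by (rule Inf_nat_def1)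
  then obtain E where "finite E \<and> spanning f n e E" "spanning_number f n e = card E" by auto
  then show ?thesis using that[of E] by simp
qed

lemma spanning_number_antimono:
  fixes f :: "'a::metric_space \<Rightarrow> 'a"
  assumes "compact (UNIV :: 'a set)" "continuous_on UNIV f" "0 < e" "e \<le> e'"
  shows "spanning_number f n e' \<le> spanning_number f n e"
proof -
  obtain E where E: "finite E" "spanning f n e E" "card E = spanning_number f n e"
    using spanning_number_attained assms by blast
  have "spanning f n e' E"
    unfolding spanning_def
  proof
    fix x
    obtain y where "y \<in> E" "\<forall>i<n. dist ((f ^^ i) x) ((f ^^ i) y) \<le> e"
      using E(2) unfolding spanning_def by blast
    then show "\<exists>y\<in>E. \<forall>i<n. dist ((f ^^ i) x) ((f ^^ i) y) \<le> e'"
      using \<open>e \<le> e'\<close> by (intro bexI[of _ y]) auto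
  qed
  then show ?thesis using spanning_number_le_card[of E f n e'] E by simp
qed

lemma topological_entropy_eq_SUP:
  fixes f :: "'a::metric_space \<Rightarrow> 'a"
  assumes "compact (UNIV :: 'a set)" "continuous_on UNIV f"
  shows "topological_entropy f =
    (SUP e\<in>{0<..}. limsup (\<lambda>n. ereal (ln (real (spanning_number f n e)) / real n)))"
  unfolding topological_entropy_def
proof (rule Lim_at_right_0_eq_SUP, rule Limsup_mono, rule always_eventually, rule allI)
  fix x y :: real and n assume "0 < x" "x \<le> y"
  have le: "spanning_number f n y \<le> spanning_number f n x"
    using spanning_number_antimono assms \<open>0 < x\<close> \<open>x \<le> y\<close> by blast
  have "ln (real (spanning_number f n y)) \<le> ln (real (spanning_number f n x))"
  proof (cases "spanning_number f n y = 0")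
    case True
    then show ?thesis by (cases "spanning_number f n x = 0") auto
  next
    case False
    then show ?thesis using le by simp
  qed
  then have "ln (real (spanning_number f n y)) / real n \<le> ln (real (spanning_number f n x)) / real n"
    by (rule divide_right_mono) simp
  then show "ereal (ln (real (spanning_number f n y)) / real n)
        \<le> ereal (ln (real (spanning_number f n x)) / real n)"
    by (rule ereal_less_eq(3)[THEN iffD2])
qed

lemma entropy_less_imp_spanning_number_less:
  fixes f :: "'a::metric_space \<Rightarrow> 'a"
  assumes "compact (UNIV :: 'a set)" "continuous_on UNIV f"
    and "topological_entropy f < ereal a" "e > 0"
  shows "\<forall>\<^sub>F n in sequentially. real (spanning_number f n e) < exp (a * real n)"
proof -
  have "limsup (\<lambda>n. ereal (ln (real (spanning_number f n e)) / real n)) \<le> topological_entropy f"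
    unfolding topological_entropy_eq_SUP[OF assms(1,2)] using \<open>e > 0\<close> by (intro SUP_upper) simp
  with assms(3) have "limsup (\<lambda>n. ereal (ln (real (spanning_number f n e)) / real n)) < ereal a"
    by (rule order.strict_trans1[rotated])
  then have "\<forall>\<^sub>F n in sequentially. ereal (ln (real (spanning_number f n e)) / real n) < ereal a"
    by (rule Limsup_lessD)
  then show ?thesis
    using eventually_gt_at_top[of 0]
  proof eventually_elim
    case (elim n)
    then have "ln (real (spanning_number f n e)) < a * real n"
      by (simp add: field_simps)
    then show ?case
      using exp_less_mono[of "ln (real (spanning_number f n e))" "a * real n"]
      by (cases "spanning_number f n e = 0") simp_all
  qed
qed

lemma less_entropy_imp_spanning_number_large:
  fixes f :: "'a::metric_space \<Rightarrow> 'a"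
  assumes "compact (UNIV :: 'a set)" "continuous_on UNIV f"
    and "ereal a < topological_entropy f" "a \<ge> 0"
  obtains e where "e > 0" "\<exists>\<^sub>F n in sequentially. exp (a * real n) < real (spanning_number f n e)"
proof -
  obtain e where e: "e > 0"
    and l: "ereal a < limsup (\<lambda>n. ereal (ln (real (spanning_number f n e)) / real n))"
    using assms(3) unfolding topological_entropy_eq_SUP[OF assms(1,2)]
    by (auto simp: less_SUP_iff)
  have "\<exists>\<^sub>F n in sequentially. ereal a < ereal (ln (real (spanning_number f n e)) / real n)"
  proof (rule ccontr)
    assume "\<not> ?thesis"
    then have "limsup (\<lambda>n. ereal (ln (real (spanning_number f n e)) / real n)) \<le> ereal a"
      by (intro Limsup_bounded) (auto simp: not_frequently not_less)
    with l show False by simp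
  qed
  then have "\<exists>\<^sub>F n in sequentially. exp (a * real n) < real (spanning_number f n e)"
  proof (rule frequently_rev_mp, intro always_eventually allI impI)
    fix n assume "ereal a < ereal (ln (real (spanning_number f n e)) / real n)"
    then have *: "a < ln (real (spanning_number f n e)) / real n" by simp
    then have "n > 0" using assms(4) by (intro gr0I) auto
    then have "a * real n < ln (real (spanning_number f n e))" using * by (simp add: field_simps)
    moreover from this have "spanning_number f n e > 0"
      using assms(4) by (intro gr0I) (auto simp: mult_less_0_iff)
    ultimately show "exp (a * real n) < real (spanning_number f n e)"
      using exp_less_mono[of "a * real n" "ln (real (spanning_number f n e))"] by simp
  qed
  with e show ?thesis using that by blast
qed

section \<open>Counting the mismatches of two orbits\<close>

text \<open>Mistakes of an orbit are counted at integer times only, and with a tolerance that is kept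
  separate from their number. Discrete counts make the tracing conditions closed, which the
  passage to infinite sequences of segments needs.\<close>

definition mismatch :: "('a::metric_space \<Rightarrow> 'a) \<Rightarrow> real \<Rightarrow> nat \<Rightarrow> 'a \<Rightarrow> 'a \<Rightarrow> nat" where
  "mismatch f e n x y = card {i\<in>{..<n}. e < dist ((f ^^ i) x) ((f ^^ i) y)}"

lemma mismatch_commute: "mismatch f e n x y = mismatch f e n y x"
  by (simp add: mismatch_def dist_commute)

lemma mismatch_triangle:
  "mismatch f (a + b) n x z \<le> mismatch f a n x y + mismatch f b n y z"
proof -
  have "{i\<in>{..<n}. a + b < dist ((f ^^ i) x) ((f ^^ i) z)} \<subseteq>
    {i\<in>{..<n}. a < dist ((f ^^ i) x) ((f ^^ i) y)} \<union> {i\<in>{..<n}. b < dist ((f ^^ i) y) ((f ^^ i) z)}"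
  proof
    fix i assume "i \<in> {i\<in>{..<n}. a + b < dist ((f ^^ i) x) ((f ^^ i) z)}"
    then show "i \<in> {i\<in>{..<n}. a < dist ((f ^^ i) x) ((f ^^ i) y)} \<union>
        {i\<in>{..<n}. b < dist ((f ^^ i) y) ((f ^^ i) z)}"
      using dist_triangle[of "(f ^^ i) x" "(f ^^ i) z" "(f ^^ i) y"] by auto
  qed
  then have "mismatch f (a + b) n x z \<le> card ({i\<in>{..<n}. a < dist ((f ^^ i) x) ((f ^^ i) y)} \<union>
      {i\<in>{..<n}. b < dist ((f ^^ i) y) ((f ^^ i) z)})"
    unfolding mismatch_def by (intro card_mono) auto
  then show ?thesis
    unfolding mismatch_def by (meson card_Un_le order_trans)
qed

lemma mismatch_antimono: "a \<le> b \<Longrightarrow> mismatch f b n x y \<le> mismatch f a n x y"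
  unfolding mismatch_def by (intro card_mono) auto

lemma mismatch_eq_0_iff:
  "mismatch f e n x y = 0 \<longleftrightarrow> (\<forall>i<n. dist ((f ^^ i) x) ((f ^^ i) y) \<le> e)"
  by (auto simp: mismatch_def)

definition sparse_sets :: "real \<Rightarrow> nat \<Rightarrow> nat set set" where
  "sparse_sets \<kappa> n = {I. I \<subseteq> {..<n} \<and> real (card I) \<le> \<kappa> * real n}"

lemma finite_sparse_sets: "finite (sparse_sets \<kappa> n)"
  unfolding sparse_sets_def by (rule finite_subset[of _ "Pow {..<n}"]) auto

lemma sum_Pow_power_card:
  fixes y :: "'b::comm_semiring_1"
  assumes "finite A"
  shows "(\<Sum>I\<in>Pow A. y ^ card I) = (1 + y) ^ card A"
proof -
  have "(1 + y) ^ card A = (\<Prod>x\<in>A. y + 1)" by (simp add: add.commute)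
  also have "\<dots> = (\<Sum>I\<in>Pow A. y ^ card I)"
    by (subst prod_add[OF assms]) simp
  finally show ?thesis ..
qed

text \<open>Chernoff's trick: weight a set \<open>I\<close> of size \<open>i\<close> by \<open>q ^ i\<close> with a small \<open>q\<close>. A sparse set has
  weight at least \<open>q powr (\<kappa> * n)\<close>, and the weighted sum of \<open>C ^ i\<close> over all subsets is \<open>(1 + q * C) ^ n\<close>.
  The bases of both powers tend to 1 when first \<open>q\<close> and then \<open>\<kappa>\<close> is chosen small.\<close>

lemma sparse_codes_few:
  fixes C :: nat
  assumes "\<gamma> > 0"
  obtains \<kappa> where "\<kappa> > 0"
    "\<And>n. (\<Sum>I\<in>sparse_sets \<kappa> n. real C ^ card I) \<le> exp (\<gamma> * real n)"
proof -
  define q where "q = min (1/2) (\<gamma> / (2 * (real C + 1)))"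
  have q: "0 < q" "q < 1" and "q \<le> \<gamma> / (2 * (real C + 1))" using assms by (auto simp: q_def)
  then have qC: "q * real C \<le> \<gamma> / 2" by (simp add: field_simps)
  have lq: "- ln q > 0" using q by simp
  \<comment> \<open>with this value, \<open>q powr (\<kappa> * n)\<close> is exactly \<open>exp (- (\<gamma> / 2) * n)\<close>\<close>
  define \<kappa> where "\<kappa> = \<gamma> / (2 * - ln q)"
  have "\<kappa> > 0" unfolding \<kappa>_def using lq assms by (intro divide_pos_pos mult_pos_pos) auto
  moreover have "(\<Sum>I\<in>sparse_sets \<kappa> n. real C ^ card I) \<le> exp (\<gamma> * real n)" for n
  proof -
    have "(\<Sum>I\<in>sparse_sets \<kappa> n. real C ^ card I) * q powr (\<kappa> * real n)
        = (\<Sum>I\<in>sparse_sets \<kappa> n. real C ^ card I * q powr (\<kappa> * real n))"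
      by (simp add: sum_distrib_right)
    also have "\<dots> \<le> (\<Sum>I\<in>sparse_sets \<kappa> n. (q * real C) ^ card I)"
    proof (rule sum_mono)
      fix I assume "I \<in> sparse_sets \<kappa> n"
      then have "q powr (\<kappa> * real n) \<le> q powr real (card I)"
        using q by (intro powr_mono') (auto simp: sparse_sets_def)
      also have "\<dots> = q ^ card I" using q by (simp add: powr_realpow)
      finally show "real C ^ card I * q powr (\<kappa> * real n) \<le> (q * real C) ^ card I"
        by (subst power_mult_distrib, subst mult.commute) (intro mult_right_mono, auto)
    qed
    also have "\<dots> \<le> (\<Sum>I\<in>Pow {..<n}. (q * real C) ^ card I)"
      using q by (intro sum_mono2) (auto simp: sparse_sets_def)
    also have "\<dots> = (1 + q * real C) ^ n" by (simp add: sum_Pow_power_card)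
    also have "1 + q * real C \<le> exp (\<gamma> / 2)"
      using qC exp_ge_add_one_self[of "\<gamma> / 2"] by linarith
    then have "(1 + q * real C) ^ n \<le> exp (\<gamma> / 2) ^ n"
      using q by (intro power_mono) auto
    also have "\<dots> = exp (\<gamma> / 2 * real n)"
      by (metis exp_of_nat_mult mult.commute)
    finally have le: "(\<Sum>I\<in>sparse_sets \<kappa> n. real C ^ card I) * q powr (\<kappa> * real n) \<le> exp (\<gamma> / 2 * real n)" .
    have "q powr (\<kappa> * real n) = exp (\<kappa> * ln q * real n)"
      using q by (simp add: powr_def mult_ac)
    also have "\<kappa> * ln q = - (\<gamma> / 2)" using lq by (simp add: \<kappa>_def field_simps)
    finally have pw: "q powr (\<kappa> * real n) = exp (- (\<gamma> / 2) * real n)" .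
    have "(\<Sum>I\<in>sparse_sets \<kappa> n. real C ^ card I)
        = (\<Sum>I\<in>sparse_sets \<kappa> n. real C ^ card I) * q powr (\<kappa> * real n) * exp (\<gamma> / 2 * real n)"
      by (simp add: pw mult.assoc flip: exp_add)
    also have "\<dots> \<le> exp (\<gamma> / 2 * real n) * exp (\<gamma> / 2 * real n)"
      using le by (intro mult_right_mono) auto
    also have "\<dots> = exp (\<gamma> * real n)" by (simp flip: exp_add)
    finally show ?thesis .
  qed
  ultimately show ?thesis using that by blast
qed

text \<open>A point with at most \<open>\<kappa> * n\<close> mismatches against \<open>p\<close> is located up to \<open>e\<close>, at all times, by the sparse
  set of its mismatches and by an itinerary through \<open>C\<close> along that set.\<close>

lemma spanning_number_le_of_mismatch_cover:
  fixes f :: "'a::metric_space \<Rightarrow> 'a"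
  assumes C: "finite C" "\<And>x::'a. \<exists>c\<in>C. dist x c \<le> e / 2"
    and P: "finite P" "\<And>x. \<exists>p\<in>P. real (mismatch f (e / 2) n x p) \<le> \<kappa> * real n"
  shows "real (spanning_number f n e)
    \<le> real (card P) * (\<Sum>I\<in>sparse_sets \<kappa> n. real (card C) ^ card I)"
proof -
  define codes :: "('a \<times> nat set \<times> (nat \<Rightarrow> 'a)) set" where "codes = P \<times> (SIGMA I:sparse_sets \<kappa> n. I \<rightarrow>\<^sub>E C)"
  \<comment> \<open>two points of a cell are within \<open>e\<close> at all times, being within \<open>e / 2\<close> of the same reference\<close>
  define cell where "cell = (\<lambda>(p, I, s).
    {y. \<forall>i<n. dist ((f ^^ i) y) (if i \<in> I then s i else (f ^^ i) p) \<le> e / 2})"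
  have finI: "finite I" if "I \<in> sparse_sets \<kappa> n" for I
    using that finite_subset[of I "{..<n}"] by (auto simp: sparse_sets_def)
  have fin: "finite (SIGMA I:sparse_sets \<kappa> n. I \<rightarrow>\<^sub>E C)"
    using finite_sparse_sets finI C by (auto intro!: finite_SigmaI finite_PiE)
  then have fc: "finite codes" using P by (simp add: codes_def)
  have "spanning f n e ((\<lambda>c. SOME y. y \<in> cell c) ` codes)"
    unfolding spanning_def
  proof (intro allI)
    fix x
    obtain p where p: "p \<in> P" "real (mismatch f (e / 2) n x p) \<le> \<kappa> * real n" using P by blast
    define I where "I = {i\<in>{..<n}. e / 2 < dist ((f ^^ i) x) ((f ^^ i) p)}"
    obtain net where net: "\<And>x. net x \<in> C" "\<And>x. dist x (net x) \<le> e / 2" using C by metis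
    define s where "s = restrict (\<lambda>i. net ((f ^^ i) x)) I"
    have c: "(p, I, s) \<in> codes"
      using p net by (auto simp: codes_def sparse_sets_def I_def mismatch_def s_def)
    have x: "x \<in> cell (p, I, s)"
      unfolding cell_def using net by (auto simp: s_def I_def not_less)
    define y where "y = (SOME y. y \<in> cell (p, I, s))"
    have y: "y \<in> cell (p, I, s)" unfolding y_def using x by (rule someI)
    have "dist ((f ^^ i) x) ((f ^^ i) y) \<le> e" if "i < n" for i
    proof -
      define w where "w = (if i \<in> I then s i else (f ^^ i) p)"
      have "dist ((f ^^ i) x) w \<le> e / 2" "dist ((f ^^ i) y) w \<le> e / 2"
        using x y that by (auto simp: cell_def w_def)
      then show ?thesis using dist_triangle2[of "(f ^^ i) x" "(f ^^ i) y" w] by simp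
    qed
    then show "\<exists>y\<in>(\<lambda>c. SOME y. y \<in> cell c) ` codes. \<forall>i<n. dist ((f ^^ i) x) ((f ^^ i) y) \<le> e"
      using c unfolding y_def by blast
  qed
  then have "spanning_number f n e \<le> card ((\<lambda>c. SOME y. y \<in> cell c) ` codes)"
    using fc by (intro spanning_number_le_card) auto
  also have "\<dots> \<le> card codes" using fc by (rule card_image_le)
  also have "\<dots> = card P * (\<Sum>I\<in>sparse_sets \<kappa> n. card C ^ card I)"
    using finite_sparse_sets finI C by (simp add: codes_def card_cartesian_product card_PiE finite_PiE)
  finally have "real (spanning_number f n e)
      \<le> real (card P * (\<Sum>I\<in>sparse_sets \<kappa> n. card C ^ card I))"
    by (rule of_nat_mono)
  then show ?thesis by simp
qed

section \<open>Birkhoff sums\<close>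

definition birkhoff_sum :: "('a \<Rightarrow> 'a) \<Rightarrow> ('a \<Rightarrow> real) \<Rightarrow> nat \<Rightarrow> 'a \<Rightarrow> real" where
  "birkhoff_sum f \<psi> n x = (\<Sum>i<n. \<psi> ((f ^^ i) x))"

lemma birkhoff_sum_add:
  "birkhoff_sum f \<psi> (m + n) x = birkhoff_sum f \<psi> m x + birkhoff_sum f \<psi> n ((f ^^ m) x)"
  unfolding birkhoff_sum_def
  by (induction n) (simp_all add: funpow_add add.commute[of m] algebra_simps)

lemma abs_birkhoff_sum_le:
  assumes "\<And>x. \<bar>\<psi> x\<bar> \<le> K"
  shows "\<bar>birkhoff_sum f \<psi> n x\<bar> \<le> K * real n"
proof -
  have "\<bar>birkhoff_sum f \<psi> n x\<bar> \<le> (\<Sum>i<n. \<bar>\<psi> ((f ^^ i) x)\<bar>)"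
    unfolding birkhoff_sum_def by (rule sum_abs)
  also have "\<dots> \<le> (\<Sum>i<n. K)" by (intro sum_mono assms)
  finally show ?thesis by (simp add: mult.commute)
qed

lemma birkhoff_sum_mult:
  "birkhoff_sum f \<psi> (q * L) x = (\<Sum>s<q. birkhoff_sum f \<psi> L ((f ^^ (s * L)) x))"
proof (induction q)
  case 0
  show ?case by (simp add: birkhoff_sum_def)
next
  case (Suc q)
  have "birkhoff_sum f \<psi> (Suc q * L) x = birkhoff_sum f \<psi> (q * L + L) x"
    by (simp add: add.commute)
  then show ?case using Suc by (simp only: birkhoff_sum_add sum.lessThan_Suc)
qed

lemma birkhoff_sum_diff_le_mismatch:
  assumes osc: "\<And>x y. dist x y \<le> \<epsilon> \<Longrightarrow> \<bar>\<psi> x - \<psi> y\<bar> \<le> \<eta>" and K: "\<And>x. \<bar>\<psi> x\<bar> \<le> K"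
    and mm: "real (mismatch f \<epsilon> n x y) \<le> \<gamma> * real n" and "0 \<le> \<eta>" "0 \<le> K"
  shows "\<bar>birkhoff_sum f \<psi> n x - birkhoff_sum f \<psi> n y\<bar> \<le> (\<eta> + 2 * K * \<gamma>) * real n"
proof -
  define bad where "bad i \<longleftrightarrow> \<epsilon> < dist ((f ^^ i) x) ((f ^^ i) y)" for i
  have "\<bar>birkhoff_sum f \<psi> n x - birkhoff_sum f \<psi> n y\<bar>
      \<le> (\<Sum>i<n. \<bar>\<psi> ((f ^^ i) x) - \<psi> ((f ^^ i) y)\<bar>)"
    unfolding birkhoff_sum_def sum_subtractf[symmetric] by (rule sum_abs)
  also have "\<dots> \<le> (\<Sum>i<n. \<eta> + (if bad i then 2 * K else 0))"
  proof (rule sum_mono)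
    fix i
    show "\<bar>\<psi> ((f ^^ i) x) - \<psi> ((f ^^ i) y)\<bar> \<le> \<eta> + (if bad i then 2 * K else 0)"
      using osc[of "(f ^^ i) x" "(f ^^ i) y"] K[of "(f ^^ i) x"] K[of "(f ^^ i) y"] \<open>0 \<le> \<eta>\<close>
      by (cases "bad i") (auto simp: bad_def)
  qed
  also have "\<dots> = \<eta> * real n + 2 * K * real (mismatch f \<epsilon> n x y)"
    by (simp add: sum.distrib sum.If_cases mismatch_def bad_def Int_def)
  also have "\<dots> \<le> \<eta> * real n + 2 * K * (\<gamma> * real n)"
    using mm \<open>0 \<le> K\<close> by (intro add_left_mono mult_left_mono) auto
  finally show ?thesis by (simp add: algebra_simps)
qed

text \<open>If the sums of length \<open>r\<close> were nearly constant, cutting a long orbit into pieces of length \<open>r\<close>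
  would pin down all its long averages. So the oscillation of the averages of one point forces
  an oscillation between points at every length, of a size independent of that length.\<close>

lemma gap_of_divergent_averages:
  assumes K: "\<And>x. \<bar>\<psi> x\<bar> \<le> K" and "0 \<le> K"
    and div: "\<not> convergent (\<lambda>n. birkhoff_sum f \<psi> n x / real n)"
  obtains G where "G > 0"
    "\<And>r. r > 0 \<Longrightarrow> \<exists>y y'. birkhoff_sum f \<psi> r y - birkhoff_sum f \<psi> r y' \<ge> G * real r"
proof -
  let ?A = "\<lambda>n. birkhoff_sum f \<psi> n x / real n"
  have "\<not> Cauchy ?A" using div Cauchy_convergent by blast
  then obtain g where g: "g > 0" "\<And>N. \<exists>m\<ge>N. \<exists>n\<ge>N. g \<le> \<bar>?A m - ?A n\<bar>"
    unfolding Cauchy_def by (force simp: dist_real_def not_less)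
  have "\<exists>y y'. birkhoff_sum f \<psi> r y - birkhoff_sum f \<psi> r y' \<ge> g / 4 * real r" if r: "r > 0" for r
  proof (rule ccontr)
    assume "\<not> ?thesis"
    then have small: "birkhoff_sum f \<psi> r y - birkhoff_sum f \<psi> r y' \<le> g / 4 * real r" for y y'
      by (meson less_imp_le not_le)
    define a where "a = birkhoff_sum f \<psi> r x"
    have a: "\<bar>a\<bar> \<le> K * real r" unfolding a_def by (rule abs_birkhoff_sum_le[OF K])
    have dev: "\<bar>?A m - a / real r\<bar> \<le> g / 4 + 2 * K * real r / real m" if "m > 0" for m
    proof -
      define q t where "q = m div r" and "t = m mod r"
      have m: "m = q * r + t" "t < r" using r by (simp_all add: q_def t_def)
      have "\<bar>birkhoff_sum f \<psi> (q * r) x - real q * a\<bar>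
          = \<bar>\<Sum>s<q. birkhoff_sum f \<psi> r ((f ^^ (s * r)) x) - a\<bar>"
        by (simp add: birkhoff_sum_mult sum_subtractf)
      also have "\<dots> \<le> (\<Sum>s<q. \<bar>birkhoff_sum f \<psi> r ((f ^^ (s * r)) x) - a\<bar>)" by (rule sum_abs)
      also have "\<dots> \<le> (\<Sum>s<q. g / 4 * real r)"
        using small by (intro sum_mono abs_leI) (simp_all add: a_def)
      finally have 1: "\<bar>birkhoff_sum f \<psi> (q * r) x - real q * a\<bar> \<le> g / 4 * real (q * r)"
        by (simp add: mult_ac)
      have 2: "\<bar>birkhoff_sum f \<psi> t ((f ^^ (q * r)) x)\<bar> \<le> K * real r"
        using abs_birkhoff_sum_le[of \<psi> K f t "(f ^^ (q * r)) x"] K m(2) \<open>0 \<le> K\<close>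
        by (meson less_imp_le mult_left_mono of_nat_le_iff order_trans)
      have "\<bar>a\<bar> * (real t / real r) \<le> \<bar>a\<bar> * 1"
        using m(2) by (intro mult_left_mono) auto
      then have 3: "\<bar>a * (real t / real r)\<bar> \<le> K * real r" using a by (simp add: abs_mult)
      have "real m * (a / real r) = real q * a + a * (real t / real r)"
        using r by (simp add: m(1) field_simps)
      moreover have "birkhoff_sum f \<psi> m x
          = birkhoff_sum f \<psi> (q * r) x + birkhoff_sum f \<psi> t ((f ^^ (q * r)) x)"
        by (simp add: m(1) birkhoff_sum_add)
      moreover have "g / 4 * real (q * r) \<le> g / 4 * real m"
        using g(1) m(1) by (intro mult_left_mono) auto
      ultimately have "\<bar>birkhoff_sum f \<psi> m x - real m * (a / real r)\<bar> \<le> g / 4 * real m + 2 * K * real r"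
        using 1 2 3 by linarith
      moreover have "?A m - a / real r = (birkhoff_sum f \<psi> m x - real m * (a / real r)) / real m"
        using \<open>m > 0\<close> by (simp add: diff_divide_distrib)
      ultimately show ?thesis using \<open>m > 0\<close> by (simp add: abs_divide field_simps)
    qed
    obtain N :: nat where N: "real N > 16 * K * real r / g" using reals_Archimedean2 by blast
    obtain m n where mn: "m \<ge> N + 1" "n \<ge> N + 1" "g \<le> \<bar>?A m - ?A n\<bar>" using g(2) by blast
    have tail: "2 * K * real r / real m < g / 8" if "m \<ge> N + 1" for m
    proof -
      have "16 * K * real r < g * real N" using N g(1) by (simp add: field_simps)
      also have "\<dots> \<le> g * real m" using that g(1) by (intro mult_left_mono) auto
      finally show ?thesis using that by (simp add: field_simps)
    qed
    show False
      using dev[of m] dev[of n] tail[of m] tail[of n] mn g(1) by linarith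
  qed
  then show ?thesis using that[of "g / 4"] g(1) by simp
qed

text \<open>If the means converged, so would the means over the dyadic windows, because such a window
  makes up half of an initial segment.\<close>

lemma divergent_of_dyadic_oscillation:
  fixes v :: "nat \<Rightarrow> real"
  assumes hi: "\<And>k s. even k \<Longrightarrow> 2 ^ k \<le> s \<Longrightarrow> s < 2 ^ (k + 1) \<Longrightarrow> Vp \<le> v s"
    and lo: "\<And>k s. odd k \<Longrightarrow> 2 ^ k \<le> s \<Longrightarrow> s < 2 ^ (k + 1) \<Longrightarrow> v s \<le> Vm"
    and "Vm < Vp"
  shows "\<not> convergent (\<lambda>q. (\<Sum>s<q. v s) / real q)"
proof
  assume "convergent (\<lambda>q. (\<Sum>s<q. v s) / real q)"
  then obtain c where c: "(\<lambda>q. (\<Sum>s<q. v s) / real q) \<longlonglongrightarrow> c" by (auto simp: convergent_def)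
  define b where "b k = (\<Sum>s<2 ^ k. v s) / 2 ^ k" for k :: nat
  have "(\<lambda>k. (\<Sum>s<2 ^ k. v s) / real (2 ^ k)) \<longlonglongrightarrow> c"
    using LIMSEQ_subseq_LIMSEQ[OF c, of "\<lambda>k. 2 ^ k"] by (simp add: strict_mono_def o_def)
  then have b: "b \<longlonglongrightarrow> c" by (simp add: b_def[abs_def])
  \<comment> \<open>the mean over the window from \<open>2 ^ k\<close> to \<open>2 ^ (k + 1)\<close>\<close>
  define w where "w k = 2 * b (Suc k) - b k" for k
  have "(\<lambda>k. 2 * b (Suc k) - b k) \<longlonglongrightarrow> 2 * c - c"
    by (intro tendsto_intros b LIMSEQ_Suc)
  then have w: "w \<longlonglongrightarrow> c" by (simp add: w_def[abs_def])
  have w_eq: "w k * 2 ^ k = (\<Sum>s\<in>{2 ^ k..<2 ^ (k + 1)}. v s)" for k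
  proof -
    have "(\<Sum>s<2 ^ (k + 1). v s) = (\<Sum>s<2 ^ k. v s) + (\<Sum>s\<in>{2 ^ k..<2 ^ (k + 1)}. v s)"
      by (simp add: lessThan_atLeast0 sum.atLeastLessThan_concat)
    then show ?thesis by (simp add: w_def b_def field_simps)
  qed
  have "Vp \<le> w (2 * k)" for k
  proof -
    have "(\<Sum>s\<in>{2 ^ (2 * k)..<2 ^ (2 * k + 1)::nat}. Vp) \<le> (\<Sum>s\<in>{2 ^ (2 * k)..<2 ^ (2 * k + 1)}. v s)"
      by (intro sum_mono hi[of "2 * k"]) auto
    then have "Vp * 2 ^ (2 * k) \<le> w (2 * k) * 2 ^ (2 * k)"
      unfolding w_eq by (simp add: mult.commute)
    then show ?thesis by simp
  qed
  moreover have "(\<lambda>k. w (2 * k)) \<longlonglongrightarrow> c"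
    using LIMSEQ_subseq_LIMSEQ[OF w, of "\<lambda>k. 2 * k"] by (simp add: strict_mono_def o_def)
  ultimately have "Vp \<le> c" by (intro LIMSEQ_le_const) auto
  have "w (2 * k + 1) \<le> Vm" for k
  proof -
    have "(\<Sum>s\<in>{2 ^ (2 * k + 1)..<2 ^ (2 * k + 1 + 1)}. v s)
        \<le> (\<Sum>s\<in>{2 ^ (2 * k + 1)..<2 ^ (2 * k + 1 + 1)::nat}. Vm)"
      by (intro sum_mono lo[of "2 * k + 1"]) auto
    then have "w (2 * k + 1) * 2 ^ (2 * k + 1) \<le> Vm * 2 ^ (2 * k + 1)"
      unfolding w_eq by (simp add: mult.commute)
    then show ?thesis by simp
  qed
  moreover have "(\<lambda>k. w (2 * k + 1)) \<longlonglongrightarrow> c"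
    using LIMSEQ_subseq_LIMSEQ[OF w, of "\<lambda>k. 2 * k + 1"] by (simp add: strict_mono_def o_def)
  ultimately have "c \<le> Vm" by (intro LIMSEQ_le_const2) auto
  with \<open>Vp \<le> c\<close> \<open>Vm < Vp\<close> show False by simp
qed

section \<open>Separated sets with many points and nearly equal averages\<close>

text \<open>A maximal separated set exists because two points assigned to the same element of a spanning
  set at half the scale have no mismatch at all, which bounds the size of separated sets.\<close>

lemma maximal_mismatch_separated:
  fixes f :: "'a::metric_space \<Rightarrow> 'a"
  assumes "compact (UNIV :: 'a set)" "continuous_on UNIV f" and e: "e > 0" and "\<kappa> \<ge> 0"
  obtains P where "finite P"
    "\<And>p q. p \<in> P \<Longrightarrow> q \<in> P \<Longrightarrow> p \<noteq> q \<Longrightarrow> \<kappa> * real n < real (mismatch f e n p q)"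
    "\<And>x. \<exists>p\<in>P. real (mismatch f e n x p) \<le> \<kappa> * real n"
proof -
  define sep where "sep P \<longleftrightarrow> finite P \<and>
    (\<forall>p\<in>P. \<forall>q\<in>P. p \<noteq> q \<longrightarrow> \<kappa> * real n < real (mismatch f e n p q))" for P
  obtain E where E: "finite E" "spanning f n (e / 2) E"
    using finite_spanning_exists[OF assms(1,2), of "e / 2" n] e by auto
  obtain c where c: "\<And>x. c x \<in> E" "\<And>x i. i < n \<Longrightarrow> dist ((f ^^ i) x) ((f ^^ i) (c x)) \<le> e / 2"
    using E(2) unfolding spanning_def by metis
  have bound: "card P < card E + 1" if "sep P" for P
  proof -
    have "inj_on c P"
    proof (rule inj_onI, rule ccontr)
      fix p q assume *: "p \<in> P" "q \<in> P" "c p = c q" "p \<noteq> q"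
      have "dist ((f ^^ i) p) ((f ^^ i) q) \<le> e" if "i < n" for i
        using c(2)[OF that, of p] c(2)[OF that, of q] *(3)
          dist_triangle2[of "(f ^^ i) p" "(f ^^ i) q" "(f ^^ i) (c q)"] by simp
      then have "mismatch f e n p q = 0" by (simp add: mismatch_eq_0_iff)
      moreover have "\<kappa> * real n < real (mismatch f e n p q)" using \<open>sep P\<close> * by (auto simp: sep_def)
      moreover have "0 \<le> \<kappa> * real n" using \<open>\<kappa> \<ge> 0\<close> by simp
      ultimately show False by simp
    qed
    then show ?thesis using c(1) E(1) card_inj_on_le[of c P E] by fastforce
  qed
  have "sep {}" by (simp add: sep_def)
  then obtain P where P: "sep P" "\<And>Q. sep Q \<Longrightarrow> card Q \<le> card P"
    using ex_has_greatest_nat[of sep "{}" card "card E + 1"] bound by blast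
  have "\<exists>p\<in>P. real (mismatch f e n x p) \<le> \<kappa> * real n" for x
  proof (rule ccontr)
    assume "\<not> ?thesis"
    then have far: "\<kappa> * real n < real (mismatch f e n x p)" if "p \<in> P" for p using that by auto
    have "mismatch f e n x x = 0" using e by (simp add: mismatch_eq_0_iff)
    moreover have "0 \<le> \<kappa> * real n" using \<open>\<kappa> \<ge> 0\<close> by simp
    ultimately have "x \<notin> P" using far[of x] by auto
    moreover have "sep (insert x P)"
      using P(1) far by (auto simp: sep_def mismatch_commute)
    ultimately show False using P(2)[of "insert x P"] P(1) by (simp add: sep_def)
  qed
  then show ?thesis using that[of P] P(1) by (auto simp: sep_def)
qed

text \<open>The mismatch balls around a maximal separated set \<open>P\<close> cover the space, and each is covered by at most
  \<open>exp (\<gamma> * n)\<close> Bowen balls. Hence \<open>P\<close> has almost as many points as a spanning set. Sorting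
  them by their averages into boundedly many cells costs another factor \<open>exp (\<gamma> * n)\<close>. The three constants
  are independent of \<open>\<eta>\<close>, so that \<open>\<eta>\<close> may be chosen depending on them.\<close>

lemma rich_separated_sets:
  fixes f :: "'a::metric_space \<Rightarrow> 'a"
  assumes cpt: "compact (UNIV :: 'a set)" and f: "continuous_on UNIV f"
    and K: "\<And>x. \<bar>\<psi> x\<bar> \<le> K"
    and "0 \<le> \<alpha>" "ereal \<alpha> < topological_entropy f"
  obtains e \<kappa> h where "e > 0" "\<kappa> > 0" "h > \<alpha>"
    "\<And>\<eta>. \<eta> > 0 \<Longrightarrow> \<exists>\<^sub>F n in sequentially. \<exists>P. finite P \<and> exp (h * real n) \<le> real (card P) \<and>
      (\<forall>p\<in>P. \<forall>q\<in>P. p \<noteq> q \<longrightarrow> \<kappa> * real n < real (mismatch f e n p q)) \<and>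
      (\<forall>p\<in>P. \<forall>q\<in>P. \<bar>birkhoff_sum f \<psi> n p - birkhoff_sum f \<psi> n q\<bar> \<le> \<eta> * real n)"
proof -
  obtain h1 where h1: "\<alpha> < h1" "ereal h1 < topological_entropy f"
    using ereal_dense2[OF assms(5)] by auto
  obtain e where e: "e > 0"
    and large: "\<exists>\<^sub>F n in sequentially. exp (h1 * real n) < real (spanning_number f n e)"
    using less_entropy_imp_spanning_number_large[OF cpt f h1(2)] \<open>0 \<le> \<alpha>\<close> h1(1) by auto
  obtain C where C: "finite C" "spanning f 1 (e / 2) C"
    using finite_spanning_exists[OF cpt f, of "e / 2" 1] e by auto
  then have net: "\<exists>c\<in>C. dist x c \<le> e / 2" for x by (auto simp: spanning_def)
  \<comment> \<open>an exponent to be lost twice: to the mistakes and to the pigeonhole principle\<close>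
  define \<gamma> where "\<gamma> = (h1 - \<alpha>) / 3"
  have "\<gamma> > 0" using h1 by (simp add: \<gamma>_def)
  obtain \<kappa> where \<kappa>: "\<kappa> > 0"
    "\<And>n. (\<Sum>I\<in>sparse_sets \<kappa> n. real (card C) ^ card I) \<le> exp (\<gamma> * real n)"
    using sparse_codes_few[OF \<open>\<gamma> > 0\<close>, of "card C"] by blast
  have "\<exists>\<^sub>F n in sequentially. \<exists>P. finite P \<and> exp ((h1 - 2 * \<gamma>) * real n) \<le> real (card P) \<and>
      (\<forall>p\<in>P. \<forall>q\<in>P. p \<noteq> q \<longrightarrow> \<kappa> * real n < real (mismatch f (e / 2) n p q)) \<and>
      (\<forall>p\<in>P. \<forall>q\<in>P. \<bar>birkhoff_sum f \<psi> n p - birkhoff_sum f \<psi> n q\<bar> \<le> \<eta> * real n)"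
    if "\<eta> > 0" for \<eta>
  proof -
    define V where "V = {\<lfloor>- (K / \<eta>)\<rfloor>..\<lfloor>K / \<eta>\<rfloor>}"
    have "0 \<le> K" using K[of undefined] by linarith
    then have "- (K / \<eta>) \<le> K / \<eta>" using \<open>\<eta> > 0\<close> by (simp add: field_simps)
    then have V: "finite V" "V \<noteq> {}" by (auto simp: V_def intro: floor_mono)
    have "filterlim (\<lambda>n. exp (\<gamma> * real n)) at_top sequentially"
      using \<open>\<gamma> > 0\<close> by (intro filterlim_compose[OF exp_at_top]
          filterlim_tendsto_pos_mult_at_top[OF tendsto_const] filterlim_real_sequentially)
    then have "\<forall>\<^sub>F n in sequentially. real (card V) \<le> exp (\<gamma> * real n)"
      by (simp add: filterlim_at_top)
    then have ev: "\<forall>\<^sub>F n in sequentially. real (card V) \<le> exp (\<gamma> * real n) \<and> 0 < n"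
      using eventually_gt_at_top[of 0] by eventually_elim simp
    show ?thesis
    proof (rule frequently_rev_mp[OF large], rule eventually_mono[OF ev], rule impI)
      fix n
      assume n: "real (card V) \<le> exp (\<gamma> * real n) \<and> 0 < n"
        and sp: "exp (h1 * real n) < real (spanning_number f n e)"
      obtain P where P: "finite P"
        "\<And>p q. p \<in> P \<Longrightarrow> q \<in> P \<Longrightarrow> p \<noteq> q \<Longrightarrow> \<kappa> * real n < real (mismatch f (e / 2) n p q)"
        "\<And>x. \<exists>p\<in>P. real (mismatch f (e / 2) n x p) \<le> \<kappa> * real n"
        using maximal_mismatch_separated[OF cpt f, of "e / 2" \<kappa> n] e \<kappa>(1) by auto
      have "exp (h1 * real n) \<le> real (card P) * (\<Sum>I\<in>sparse_sets \<kappa> n. real (card C) ^ card I)"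
        using spanning_number_le_of_mismatch_cover[OF C(1) net P(1,3)] sp by simp
      also have "\<dots> \<le> real (card P) * exp (\<gamma> * real n)"
        by (intro mult_left_mono \<kappa>) auto
      finally have cP: "exp (h1 * real n) \<le> real (card P) * exp (\<gamma> * real n)" .
      define cell where "cell p = \<lfloor>birkhoff_sum f \<psi> n p / (\<eta> * real n)\<rfloor>" for p
      have "cell p \<in> V" for p
      proof -
        have "\<bar>birkhoff_sum f \<psi> n p\<bar> \<le> K * real n" by (rule abs_birkhoff_sum_le[OF K])
        then have "- (K / \<eta>) \<le> birkhoff_sum f \<psi> n p / (\<eta> * real n)"
          "birkhoff_sum f \<psi> n p / (\<eta> * real n) \<le> K / \<eta>"
          using n \<open>\<eta> > 0\<close> by (auto simp: field_simps)
        then show ?thesis unfolding V_def cell_def by (simp add: floor_mono)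
      qed
      then obtain c where c: "card P \<le> card (cell -` {c} \<inter> P) * card V"
        using pigeonhole_card[of cell P V] P(1) V by auto
      define P' where "P' = cell -` {c} \<inter> P"
      have "finite P'" using P(1) by (simp add: P'_def)
      have "real (card P) \<le> real (card P') * real (card V)"
        using c by (simp add: P'_def flip: of_nat_mult)
      also have "\<dots> \<le> real (card P') * exp (\<gamma> * real n)"
        using n by (intro mult_left_mono) auto
      finally have "real (card P) * exp (\<gamma> * real n) \<le> real (card P') * exp (\<gamma> * real n) * exp (\<gamma> * real n)"
        by (intro mult_right_mono) auto
      with cP have "exp (h1 * real n) \<le> real (card P') * exp (2 * \<gamma> * real n)"
        by (simp add: mult.assoc flip: exp_add)
      then have "exp (h1 * real n) * exp (- (2 * \<gamma> * real n))
          \<le> real (card P') * exp (2 * \<gamma> * real n) * exp (- (2 * \<gamma> * real n))"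
        by (intro mult_right_mono) auto
      then have cP': "exp ((h1 - 2 * \<gamma>) * real n) \<le> real (card P')"
        by (simp add: mult.assoc left_diff_distrib flip: exp_add)
      have close: "\<bar>birkhoff_sum f \<psi> n p - birkhoff_sum f \<psi> n q\<bar> \<le> \<eta> * real n"
        if "p \<in> P'" "q \<in> P'" for p q
      proof -
        have "cell p = cell q" using that by (auto simp: P'_def)
        then have "\<bar>birkhoff_sum f \<psi> n p / (\<eta> * real n) - birkhoff_sum f \<psi> n q / (\<eta> * real n)\<bar> \<le> 1"
          unfolding cell_def by linarith
        then show ?thesis
          using n \<open>\<eta> > 0\<close> by (simp add: abs_mult field_simps flip: diff_divide_distrib)
      qed
      show "\<exists>P. finite P \<and> exp ((h1 - 2 * \<gamma>) * real n) \<le> real (card P) \<and>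
          (\<forall>p\<in>P. \<forall>q\<in>P. p \<noteq> q \<longrightarrow> \<kappa> * real n < real (mismatch f (e / 2) n p q)) \<and>
          (\<forall>p\<in>P. \<forall>q\<in>P. \<bar>birkhoff_sum f \<psi> n p - birkhoff_sum f \<psi> n q\<bar> \<le> \<eta> * real n)"
        using \<open>finite P'\<close> cP' close P(2) by (intro exI[of _ P']) (auto simp: P'_def)
    qed
  qed
  moreover have "h1 - 2 * \<gamma> > \<alpha>" using h1(1) by (simp add: \<gamma>_def field_simps)
  ultimately show ?thesis using that[of "e / 2" \<kappa> "h1 - 2 * \<gamma>"] e \<kappa>(1) by auto
qed

section \<open>Digit expansions\<close>

definition digit :: "nat \<Rightarrow> real \<Rightarrow> nat \<Rightarrow> nat" where
  "digit M u s = nat (\<lfloor>real M ^ Suc s * u\<rfloor> mod int M)"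

lemma digit_less: "M > 0 \<Longrightarrow> digit M u s < M"
  by (simp add: digit_def nat_less_iff)

text \<open>Division by \<open>M\<close> strips the last digit off \<open>\<lfloor>M ^ l * u\<rfloor>\<close>, so this integer is determined by the first
  \<open>l\<close> digits.\<close>

lemma close_of_digits_eq:
  assumes "M > 0" "u \<in> {0..<1}" "u' \<in> {0..<1}" "\<And>s. s < l \<Longrightarrow> digit M u s = digit M u' s"
  shows "\<bar>u - u'\<bar> \<le> 1 / real M ^ l"
proof -
  have "\<lfloor>real M ^ l * u\<rfloor> = \<lfloor>real M ^ l * u'\<rfloor>"
    using assms(4)
  proof (induction l)
    case 0
    have "\<lfloor>u\<rfloor> = 0" "\<lfloor>u'\<rfloor> = 0" using assms by (auto simp: floor_eq_iff)
    then show ?case by simp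
  next
    case (Suc l)
    have div: "\<lfloor>real M ^ Suc l * w\<rfloor> div int M = \<lfloor>real M ^ l * w\<rfloor>" for w
      using floor_divide_real_eq_div[of "int M" "real M ^ Suc l * w"] \<open>M > 0\<close> by simp
    have "\<lfloor>real M ^ Suc l * u\<rfloor> mod int M = \<lfloor>real M ^ Suc l * u'\<rfloor> mod int M"
      using Suc.prems[of l] \<open>M > 0\<close> by (simp add: digit_def eq_nat_nat_iff)
    moreover have "\<lfloor>real M ^ Suc l * u\<rfloor> div int M = \<lfloor>real M ^ Suc l * u'\<rfloor> div int M"
      unfolding div using Suc by simp
    ultimately show ?case by (metis div_mult_mod_eq)
  qed
  then have "\<bar>real M ^ l * u - real M ^ l * u'\<bar> \<le> 1" by linarith
  then have "real M ^ l * \<bar>u - u'\<bar> \<le> 1" by (simp add: abs_mult flip: right_diff_distrib)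
  then show ?thesis using \<open>M > 0\<close> by (simp add: field_simps)
qed

section \<open>From the flow to its time-one map\<close>

lemma flow_add: "continuous_flow \<Phi> \<Longrightarrow> \<Phi> (s + t) x = \<Phi> s (\<Phi> t x)"
  by (simp add: continuous_flow_def)

lemma flow_0: "continuous_flow \<Phi> \<Longrightarrow> \<Phi> 0 x = x"
  by (simp add: continuous_flow_def)

lemma funpow_time_one: "continuous_flow \<Phi> \<Longrightarrow> (\<Phi> 1 ^^ n) x = \<Phi> (real n) x"
  by (induction n) (simp_all add: flow_0 flow_add[symmetric])

lemma continuous_on_flow:
  assumes "continuous_flow \<Phi>" "continuous_on S g" "continuous_on S h"
  shows "continuous_on S (\<lambda>z. \<Phi> (g z) (h z))"
proof -
  have "continuous_on UNIV (\<lambda>(t, x). \<Phi> t x)" using assms(1) by (simp add: continuous_flow_def)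
  from continuous_on_compose2[OF this continuous_on_Pair[OF assms(2,3)]] show ?thesis by simp
qed

lemma continuous_on_time_map: "continuous_flow \<Phi> \<Longrightarrow> continuous_on UNIV (\<Phi> t)"
  using continuous_on_flow[of \<Phi> UNIV "\<lambda>_. t" "\<lambda>x. x"] by simp

lemma flow_equicontinuous:
  fixes \<Phi> :: "real \<Rightarrow> 'a::metric_space \<Rightarrow> 'a"
  assumes "compact (UNIV :: 'a set)" "continuous_flow \<Phi>" "\<epsilon> > 0"
  obtains \<delta> where "\<delta> > 0"
    "\<And>t x y. \<bar>t\<bar> \<le> 1 \<Longrightarrow> dist x y < \<delta> \<Longrightarrow> dist (\<Phi> t x) (\<Phi> t y) < \<epsilon>"
proof -
  have "continuous_on ({-1..1} \<times> (UNIV :: 'a set)) (\<lambda>p. \<Phi> (fst p) (snd p))"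
    by (rule continuous_on_flow[OF assms(2) continuous_on_fst[OF continuous_on_id]
          continuous_on_snd[OF continuous_on_id]])
  moreover have "compact ({-1..1 :: real} \<times> (UNIV :: 'a set))"
    by (intro compact_Times assms compact_Icc)
  ultimately have "uniformly_continuous_on ({-1..1} \<times> (UNIV :: 'a set)) (\<lambda>p. \<Phi> (fst p) (snd p))"
    by (rule compact_uniformly_continuous)
  then obtain \<delta> where \<delta>: "\<delta> > 0" "\<And>p q. p \<in> {-1..1} \<times> UNIV \<Longrightarrow> q \<in> {-1..1} \<times> UNIV \<Longrightarrow>
      dist q p < \<delta> \<Longrightarrow> dist (\<Phi> (fst q) (snd q)) (\<Phi> (fst p) (snd p)) < \<epsilon>"
    unfolding uniformly_continuous_on_def using \<open>\<epsilon> > 0\<close> by metis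
  have "dist (\<Phi> t x) (\<Phi> t y) < \<epsilon>" if "\<bar>t\<bar> \<le> 1" "dist x y < \<delta>" for t x y
    using \<delta>(2)[of "(t, y)" "(t, x)"] that by (simp add: dist_Pair_Pair abs_le_iff)
  with \<delta>(1) show ?thesis using that by blast
qed

text \<open>If the time-one map has a mismatch at \<open>i\<close>, no time in \<open>[i, i + 1)\<close> lies in the good
  set \<open>\<Lambda>\<close>, since a good time would carry closeness over to the time \<open>i\<close>. Each
  mismatch thus uses up a unit of the measure allowed for mistakes.\<close>

lemma mismatch_le_of_mistake_ball:
  assumes \<Phi>: "continuous_flow \<Phi>"
    and \<delta>: "\<And>t x y. \<bar>t\<bar> \<le> 1 \<Longrightarrow> dist x y < \<delta> \<Longrightarrow> dist (\<Phi> t x) (\<Phi> t y) < \<epsilon>"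
    and y: "y \<in> mistake_ball \<Phi> g (real n) x \<delta>"
  shows "real (mismatch (\<Phi> 1) \<epsilon> n y x) \<le> g (real n) \<delta>"
proof -
  obtain \<Lambda> where \<Lambda>: "\<Lambda> \<in> sets lebesgue" "\<Lambda> \<subseteq> {0..real n}"
    "measure lebesgue ({0..real n} - \<Lambda>) \<le> g (real n) \<delta>"
    "(SUP t\<in>\<Lambda>. ereal (dist (\<Phi> t x) (\<Phi> t y))) < ereal \<delta>"
    using y unfolding mistake_ball_def by blast
  have good: "dist (\<Phi> t x) (\<Phi> t y) < \<delta>" if "t \<in> \<Lambda>" for t
  proof -
    have "ereal (dist (\<Phi> t x) (\<Phi> t y)) < ereal \<delta>"
      using \<Lambda>(4) by (rule le_less_trans[OF SUP_upper[OF that]])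
    then show ?thesis by simp
  qed
  define J where "J = {i\<in>{..<n}. \<epsilon> < dist ((\<Phi> 1 ^^ i) y) ((\<Phi> 1 ^^ i) x)}"
  define I where "I i = {real i..<real i + 1}" for i :: nat
  have disj: "disjoint_family_on I J"
  proof (clarsimp simp: disjoint_family_on_def)
    fix m n :: nat assume "m \<noteq> n"
    then show "I m \<inter> I n = {}" unfolding I_def by (cases "m < n") auto
  qed
  have sub: "(\<Union>i\<in>J. I i) \<subseteq> {0..real n} - \<Lambda>"
  proof (intro UN_least subsetI)
    fix i t assume i: "i \<in> J" and t: "t \<in> I i"
    have "t \<notin> \<Lambda>"
    proof
      assume "t \<in> \<Lambda>"
      then have "dist (\<Phi> (real i - t) (\<Phi> t x)) (\<Phi> (real i - t) (\<Phi> t y)) < \<epsilon>"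
        using t by (intro \<delta> good) (auto simp: I_def)
      then have "dist (\<Phi> (real i) x) (\<Phi> (real i) y) < \<epsilon>" by (simp flip: flow_add[OF \<Phi>])
      with i show False by (simp add: J_def funpow_time_one[OF \<Phi>] dist_commute)
    qed
    moreover have "real i + 1 \<le> real n" using i by (auto simp: J_def)
    ultimately show "t \<in> {0..real n} - \<Lambda>" using t by (auto simp: I_def)
  qed
  have "real (mismatch (\<Phi> 1) \<epsilon> n y x) = (\<Sum>i\<in>J. measure lebesgue (I i))"
    by (simp add: mismatch_def J_def I_def)
  also have "\<dots> = measure lebesgue (\<Union>i\<in>J. I i)"
    by (rule measure_finite_Union[OF _ _ disj, symmetric]) (auto simp: J_def I_def)
  also have "\<dots> \<le> measure lebesgue ({0..real n} - \<Lambda>)"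
  proof (rule measure_mono_fmeasurable[OF sub])
    show "(\<Union>i\<in>J. I i) \<in> sets lebesgue" by (auto simp: I_def J_def)
    show "{0..real n} - \<Lambda> \<in> lmeasurable"
      using \<Lambda>(1) by (intro fmeasurable_Diff) auto
  qed
  finally show ?thesis using \<Lambda>(3) by simp
qed

text \<open>A form of almost specification for maps, with infinitely many segments at a common scale. The
  mistake function enters only through its sublinearity, as an arbitrarily small proportion \<open>\<gamma>\<close>.\<close>

definition sparse_tracing :: "('a::metric_space \<Rightarrow> 'a) \<Rightarrow> bool" where
  "sparse_tracing f \<longleftrightarrow> (\<forall>\<epsilon>>0. \<forall>\<gamma>>0. \<exists>n0. \<forall>l x. (\<forall>j::nat. n0 \<le> l j) \<longrightarrow>
     (\<exists>z. \<forall>j. real (mismatch f \<epsilon> (l j) ((f ^^ (\<Sum>i<j. l i)) z) (x j)) \<le> \<gamma> * real (l j)))"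

text \<open>The mismatch count alone is not continuous. Its sublevel sets are nevertheless closed, being finite
  unions, over the possible sets \<open>J\<close> of bad times, of intersections of closed conditions.\<close>

lemma closed_mismatch_le:
  assumes f: "continuous_on UNIV f"
  shows "closed {z. real (mismatch f \<epsilon> n ((f ^^ m) z) x) \<le> c}"
proof -
  define \<J> where "\<J> = {J. J \<subseteq> {..<n} \<and> real (card J) \<le> c}"
  have "{z. real (mismatch f \<epsilon> n ((f ^^ m) z) x) \<le> c} =
    (\<Union>J\<in>\<J>. \<Inter>i\<in>{..<n} - J. {z. dist ((f ^^ i) ((f ^^ m) z)) ((f ^^ i) x) \<le> \<epsilon>})" (is "?L = ?R")
  proof
    show "?L \<subseteq> ?R"
    proof
      fix z assume "z \<in> ?L"
      then have "{i\<in>{..<n}. \<epsilon> < dist ((f ^^ i) ((f ^^ m) z)) ((f ^^ i) x)} \<in> \<J>"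
        by (auto simp: \<J>_def mismatch_def)
      then show "z \<in> ?R" by (rule UN_I) auto
    qed
    show "?R \<subseteq> ?L"
    proof
      fix z assume "z \<in> ?R"
      then obtain J where J: "J \<in> \<J>" and
        "\<And>i. i \<in> {..<n} - J \<Longrightarrow> dist ((f ^^ i) ((f ^^ m) z)) ((f ^^ i) x) \<le> \<epsilon>" by auto
      then have "{i\<in>{..<n}. \<epsilon> < dist ((f ^^ i) ((f ^^ m) z)) ((f ^^ i) x)} \<subseteq> J" by force
      moreover have "finite J" using J finite_subset[of J "{..<n}"] by (auto simp: \<J>_def)
      ultimately have "mismatch f \<epsilon> n ((f ^^ m) z) x \<le> card J"
        unfolding mismatch_def by (intro card_mono)
      then show "z \<in> ?L" using J by (auto simp: \<J>_def)
    qed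
  qed
  moreover have "finite \<J>" unfolding \<J>_def by (rule finite_subset[of _ "Pow {..<n}"]) auto
  moreover have "closed {z. dist ((f ^^ i) ((f ^^ m) z)) ((f ^^ i) x) \<le> \<epsilon>}" for i
    using continuous_on_funpow[OF f, of "i + m"]
    by (intro closed_Collect_le continuous_on_dist continuous_on_const) (simp add: funpow_add o_def)
  ultimately show ?thesis by (auto intro!: closed_UN)
qed

lemma sparse_tracing_time_one:
  fixes \<Phi> :: "real \<Rightarrow> 'a::metric_space \<Rightarrow> 'a"
  assumes cpt: "compact (UNIV :: 'a set)" and \<Phi>: "continuous_flow \<Phi>"
    and spec: "almost_specification \<Phi>"
  shows "sparse_tracing (\<Phi> 1)"
  unfolding sparse_tracing_def
proof (intro allI impI)
  fix \<epsilon> \<gamma> :: real assume "\<epsilon> > 0" "\<gamma> > 0"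
  have cont: "continuous_on UNIV (\<Phi> 1)"
    by (rule continuous_on_time_map[OF \<Phi>])
  obtain e0 g Tg where g: "mistake_function e0 g" and "\<And>e. e > 0 \<Longrightarrow> Tg e > (0::real)"
    and tr: "\<And>k e x t. (k::nat) \<ge> 1 \<Longrightarrow> (\<And>i. i \<in> {1..k} \<Longrightarrow> e i > 0) \<Longrightarrow>
        (\<And>i. i \<in> {1..k} \<Longrightarrow> t i \<ge> Tg (e i)) \<Longrightarrow> \<exists>z. \<forall>j\<in>{1..k}.
          \<Phi> (\<Sum>i=1..<j. t i) z \<in> mistake_ball \<Phi> (mistake_ext e0 g) (t j) (x j) (e j)"
    using spec unfolding almost_specification_def by metis
  obtain \<delta> where \<delta>: "\<delta> > 0"
    "\<And>t x y. \<bar>t\<bar> \<le> 1 \<Longrightarrow> dist x y < \<delta> \<Longrightarrow> dist (\<Phi> t x) (\<Phi> t y) < \<epsilon>"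
    using flow_equicontinuous[OF cpt \<Phi> \<open>\<epsilon> > 0\<close>] by blast
  \<comment> \<open>the extended mistake function at scale \<open>\<delta>\<close> is the original one at scale \<open>e'\<close>\<close>
  define e' where "e' = min \<delta> e0"
  have e': "e' \<in> {0<..e0}" using g \<delta>(1) by (auto simp: e'_def mistake_function_def)
  have ext: "mistake_ext e0 g t \<delta> = g t e'" for t by (auto simp: mistake_ext_def e'_def)
  have "((\<lambda>t. g t e' / t) \<longlongrightarrow> 0) at_top" using g e' by (simp add: mistake_function_def)
  then have "\<forall>\<^sub>F t in at_top. g t e' / t < \<gamma>" using \<open>\<gamma> > 0\<close> by (rule order_tendstoD)
  then obtain T where T: "\<And>t. t \<ge> T \<Longrightarrow> g t e' / t < \<gamma>" unfolding eventually_at_top_linorder by blast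
  define n0 where "n0 = nat \<lceil>max (max T (Tg \<delta>)) 1\<rceil>"
  have n0: "T \<le> real n" "Tg \<delta> \<le> real n" "0 < n" if "n0 \<le> n" for n
    using that unfolding n0_def by linarith+
  show "\<exists>n0. \<forall>l x. (\<forall>j::nat. n0 \<le> l j) \<longrightarrow> (\<exists>z. \<forall>j.
      real (mismatch (\<Phi> 1) \<epsilon> (l j) ((\<Phi> 1 ^^ (\<Sum>i<j. l i)) z) (x j)) \<le> \<gamma> * real (l j))"
  proof (intro exI[of _ n0] allI impI)
    fix l :: "nat \<Rightarrow> nat" and x :: "nat \<Rightarrow> 'a" assume l: "\<forall>j. n0 \<le> l j"
    define C where "C j =
      {z. real (mismatch (\<Phi> 1) \<epsilon> (l j) ((\<Phi> 1 ^^ (\<Sum>i<j. l i)) z) (x j)) \<le> \<gamma> * real (l j)}" for j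
    have fin: "\<exists>z. \<forall>j<k. z \<in> C j" for k
    proof (cases "k = 0")
      case False
      then obtain z where z: "\<forall>j\<in>{1..k}. \<Phi> (\<Sum>i=1..<j. real (l (i - 1))) z
          \<in> mistake_ball \<Phi> (mistake_ext e0 g) (real (l (j - 1))) (x (j - 1)) \<delta>"
        using tr[of k "\<lambda>_. \<delta>" "\<lambda>i. real (l (i - 1))" "\<lambda>i. x (i - 1)"] \<delta>(1) n0(2) l by auto
      have "z \<in> C j" if "j < k" for j
      proof -
        have "(\<Sum>i=1..<Suc j. real (l (i - 1))) = real (\<Sum>i<j. l i)"
          by (induction j) auto
        then have "(\<Phi> 1 ^^ (\<Sum>i<j. l i)) z \<in> mistake_ball \<Phi> (mistake_ext e0 g) (real (l j)) (x j) \<delta>"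
          using bspec[OF z, of "Suc j"] that by (simp add: funpow_time_one[OF \<Phi>])
        then have "real (mismatch (\<Phi> 1) \<epsilon> (l j) ((\<Phi> 1 ^^ (\<Sum>i<j. l i)) z) (x j)) \<le> g (real (l j)) e'"
          using mismatch_le_of_mistake_ball[OF \<Phi> \<delta>(2)] ext by metis
        moreover have "g (real (l j)) e' < \<gamma> * real (l j)"
          using T[of "real (l j)"] n0[of "l j"] l by (simp add: field_simps)
        ultimately show ?thesis by (simp add: C_def)
      qed
      then show ?thesis by blast
    qed simp
    have "(\<Inter>j. C j) \<noteq> {}"
    proof
      assume "(\<Inter>j. C j) = {}"
      then have "UNIV \<subseteq> (\<Union>j\<in>UNIV. - C j)" by blast
      moreover have "open (- C j)" for j
        unfolding C_def by (intro open_Compl closed_mismatch_le[OF cont])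
      ultimately obtain N where N: "finite N" "UNIV \<subseteq> (\<Union>j\<in>N. - C j)"
        using compactE_image[OF cpt, of UNIV "\<lambda>j. - C j"] by metis
      obtain k where "\<And>j. j \<in> N \<Longrightarrow> j < k" using N(1) finite_nat_set_iff_bounded by metis
      moreover obtain z where "\<forall>j<k. z \<in> C j" using fin by blast
      ultimately show False using N(2) by blast
    qed
    then show "\<exists>z. \<forall>j. real (mismatch (\<Phi> 1) \<epsilon> (l j) ((\<Phi> 1 ^^ (\<Sum>i<j. l i)) z) (x j)) \<le> \<gamma> * real (l j)"
      by (auto simp: C_def)
  qed
qed

definition unit_integral :: "(real \<Rightarrow> 'a \<Rightarrow> 'a) \<Rightarrow> ('a \<Rightarrow> real) \<Rightarrow> 'a \<Rightarrow> real" where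
  "unit_integral \<Phi> \<phi> x = integral {0..1} (\<lambda>t. \<phi> (\<Phi> t x))"

lemma continuous_on_observable_flow:
  assumes "continuous_flow \<Phi>" "continuous_on UNIV \<phi>" "continuous_on S g" "continuous_on S h"
  shows "continuous_on S (\<lambda>z. \<phi> (\<Phi> (g z) (h z)))"
  using continuous_on_compose2[OF assms(2) continuous_on_flow[OF assms(1,3,4)]] by simp

lemma continuous_on_unit_integral:
  fixes \<phi> :: "'a::metric_space \<Rightarrow> real"
  assumes "continuous_flow \<Phi>" "continuous_on UNIV \<phi>"
  shows "continuous_on UNIV (unit_integral \<Phi> \<phi>)"
proof -
  have "continuous_on (UNIV \<times> cbox 0 1) (\<lambda>(x, t). \<phi> (\<Phi> t x))"
    unfolding case_prod_unfold
    by (rule continuous_on_observable_flow[OF assms continuous_on_snd[OF continuous_on_id]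
          continuous_on_fst[OF continuous_on_id]])
  from integral_continuous_on_param[OF this] show ?thesis by (simp add: unit_integral_def[abs_def])
qed

lemma integral_orbit_of_nat:
  fixes \<phi> :: "'a::metric_space \<Rightarrow> real"
  assumes \<Phi>: "continuous_flow \<Phi>" and \<phi>: "continuous_on UNIV \<phi>"
  shows "integral {0..real n} (\<lambda>t. \<phi> (\<Phi> t x)) = birkhoff_sum (\<Phi> 1) (unit_integral \<Phi> \<phi>) n x"
proof (induction n)
  case 0
  show ?case by (simp add: birkhoff_sum_def)
next
  case (Suc n)
  have int: "(\<lambda>t. \<phi> (\<Phi> t x)) integrable_on {a..b}" for a b
    by (rule integrable_continuous_real)
      (rule continuous_on_observable_flow[OF \<Phi> \<phi> continuous_on_id continuous_on_const])
  have "integral {real n..real n + 1} (\<lambda>t. \<phi> (\<Phi> t x)) = integral {0..1} (\<lambda>t. \<phi> (\<Phi> (t + real n) x))"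
    using integral_shift_Icc_real[of 0 1 "\<lambda>t. \<phi> (\<Phi> t x)" "real n"] by (simp add: o_def add.commute)
  also have "\<dots> = unit_integral \<Phi> \<phi> ((\<Phi> 1 ^^ n) x)"
    by (simp add: unit_integral_def funpow_time_one[OF \<Phi>] flow_add[OF \<Phi>])
  finally have "integral {real n..real n + 1} (\<lambda>t. \<phi> (\<Phi> t x)) = unit_integral \<Phi> \<phi> ((\<Phi> 1 ^^ n) x)" .
  moreover have "integral {0..real n} (\<lambda>t. \<phi> (\<Phi> t x)) + integral {real n..real n + 1} (\<lambda>t. \<phi> (\<Phi> t x))
      = integral {0..real n + 1} (\<lambda>t. \<phi> (\<Phi> t x))"
    by (intro Henstock_Kurzweil_Integration.integral_combine int) auto
  ultimately show ?case using Suc by (simp add: birkhoff_sum_def add.commute)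
qed

text \<open>Rounding \<open>T\<close> down to an integer changes the average over \<open>[0, T]\<close> by at most a constant times
  \<open>1 / T\<close>.\<close>

lemma irregular_points_iff_time_one:
  fixes \<phi> :: "'a::metric_space \<Rightarrow> real"
  assumes cpt: "compact (UNIV :: 'a set)" and \<Phi>: "continuous_flow \<Phi>" and \<phi>: "continuous_on UNIV \<phi>"
  shows "x \<in> irregular_points \<Phi> \<phi> \<longleftrightarrow>
    \<not> convergent (\<lambda>n. birkhoff_sum (\<Phi> 1) (unit_integral \<Phi> \<phi>) n x / real n)"
proof -
  define F where "F T = integral {0..T} (\<lambda>t. \<phi> (\<Phi> t x))" for T
  define A where "A n = birkhoff_sum (\<Phi> 1) (unit_integral \<Phi> \<phi>) n x / real n" for n
  have A: "A n = F (real n) / real n" for n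
    by (simp add: A_def F_def integral_orbit_of_nat[OF \<Phi> \<phi>])
  have int: "(\<lambda>t. \<phi> (\<Phi> t x)) integrable_on {a..b}" for a b
    by (rule integrable_continuous_real)
      (rule continuous_on_observable_flow[OF \<Phi> \<phi> continuous_on_id continuous_on_const])
  have "bounded (range \<phi>)" using cpt \<phi> by (intro compact_imp_bounded compact_continuous_image)
  then obtain K where K: "\<And>x. \<bar>\<phi> x\<bar> \<le> K" by (auto simp: bounded_iff)
  then have "0 \<le> K" by (meson abs_ge_zero order_trans)
  have bnd: "\<bar>integral {a..b} (\<lambda>t. \<phi> (\<Phi> t x))\<bar> \<le> K * (b - a)" if "a \<le> b" for a b
    using integral_bound[OF that, of "\<lambda>t. \<phi> (\<Phi> t x)" K] K
      continuous_on_observable_flow[OF \<Phi> \<phi> continuous_on_id continuous_on_const]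
    by simp
  have "((\<lambda>T. (1 / T) * F T) \<longlongrightarrow> L) at_top \<longleftrightarrow> A \<longlonglongrightarrow> L" for L
  proof
    assume "((\<lambda>T. (1 / T) * F T) \<longlongrightarrow> L) at_top"
    from filterlim_compose[OF this filterlim_real_sequentially] show "A \<longlonglongrightarrow> L"
      by (simp add: A[abs_def])
  next
    assume L: "A \<longlonglongrightarrow> L"
    have "filterlim (\<lambda>T::real. nat \<lfloor>T\<rfloor>) sequentially at_top"
      unfolding filterlim_at_top
    proof
      fix N :: nat
      show "\<forall>\<^sub>F T::real in at_top. N \<le> nat \<lfloor>T\<rfloor>"
        using eventually_ge_at_top[of "real N"] by eventually_elim (simp add: le_nat_floor)
    qed
    from filterlim_compose[OF L this] have 1: "((\<lambda>T::real. A (nat \<lfloor>T\<rfloor>)) \<longlongrightarrow> L) at_top" .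
    have "\<bar>(1 / T) * F T - A (nat \<lfloor>T\<rfloor>)\<bar> \<le> 2 * K * (1 / T)" if "T \<ge> 1" for T
    proof -
      define n where "n = nat \<lfloor>T\<rfloor>"
      have n: "real n \<le> T" "T - real n \<le> 1" "0 < n" using that unfolding n_def by linarith+
      have "F T = F (real n) + integral {real n..T} (\<lambda>t. \<phi> (\<Phi> t x))"
        unfolding F_def using n int by (intro Henstock_Kurzweil_Integration.integral_combine[symmetric]) auto
      moreover have "\<bar>integral {real n..T} (\<lambda>t. \<phi> (\<Phi> t x))\<bar> \<le> K * 1"
        using bnd[OF n(1)] n(2) \<open>0 \<le> K\<close> by (meson mult_left_mono order_trans)
      ultimately have a: "\<bar>F T - F (real n)\<bar> \<le> K" by simp
      have "\<bar>F (real n)\<bar> \<le> K * real n" using bnd[of 0 "real n"] by (simp add: F_def)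
      then have "\<bar>A n\<bar> \<le> K" using n(3) by (simp add: A field_simps)
      then have "\<bar>A n * (T - real n)\<bar> \<le> K * 1"
        unfolding abs_mult using n \<open>0 \<le> K\<close> by (intro mult_mono) auto
      moreover have "F T - T * A n = (F T - F (real n)) - A n * (T - real n)"
        using n(3) by (simp add: A field_simps)
      ultimately have "\<bar>F T - T * A n\<bar> \<le> 2 * K" using a by linarith
      moreover have "(1 / T) * F T - A n = (F T - T * A n) / T" using that by (simp add: field_simps)
      ultimately show ?thesis using that by (simp add: n_def divide_right_mono)
    qed
    then have "\<forall>\<^sub>F T in at_top. norm ((1 / T) * F T - A (nat \<lfloor>T\<rfloor>)) \<le> 2 * K * (1 / T)"
      unfolding eventually_at_top_linorder by (intro exI[of _ 1]) auto
    moreover have "((\<lambda>T::real. 2 * K * (1 / T)) \<longlongrightarrow> 0) at_top"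
    proof -
      have "((\<lambda>T::real. 2 * K * (1 / T)) \<longlongrightarrow> 2 * K * 0) at_top"
        by (intro tendsto_intros tendsto_divide_0[OF tendsto_const] filterlim_at_top_imp_at_infinity filterlim_ident)
      then show ?thesis by (simp only: mult_zero_right)
    qed
    ultimately have "((\<lambda>T. (1 / T) * F T - A (nat \<lfloor>T\<rfloor>)) \<longlongrightarrow> 0) at_top"
      by (rule Lim_null_comparison)
    from tendsto_add[OF this 1] show "((\<lambda>T. (1 / T) * F T) \<longlongrightarrow> L) at_top" by simp
  qed
  then show ?thesis
    unfolding irregular_points_def convergent_def A_def[symmetric] F_def by simp
qed

section \<open>Entropy of subsets\<close>

lemma cover_time_nonneg: "0 \<le> cover_time \<Phi> \<U> B"
  unfolding cover_time_def by (rule Sup_upper) (auto simp: zero_ereal_def)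

lemma cover_time_ge:
  assumes "0 \<le> s" "\<And>t. 0 \<le> t \<Longrightarrow> t < s \<Longrightarrow> subordinate (\<Phi> t ` B) \<U>"
  shows "ereal s \<le> cover_time \<Phi> \<U> B"
  unfolding cover_time_def by (rule Sup_upper) (use assms in auto)

lemma subordinate_before_cover_time:
  assumes "0 \<le> t" "ereal t < cover_time \<Phi> \<U> B"
  shows "subordinate (\<Phi> t ` B) \<U>"
  using assms unfolding cover_time_def by (auto simp: less_Sup_iff)

lemma cover_diam_nonneg: "0 \<le> cover_diam \<Phi> \<U> B"
  by (simp add: cover_diam_def)

lemma cover_diam_le_1: "cover_diam \<Phi> \<U> B \<le> 1"
  using cover_time_nonneg[of \<Phi> \<U> B] by (auto simp: cover_diam_def real_of_ereal_pos)

lemma cover_diam_le: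
  assumes "ereal s \<le> cover_time \<Phi> \<U> B"
  shows "cover_diam \<Phi> \<U> B \<le> exp (- s)"
  using assms by (cases "cover_time \<Phi> \<U> B") (auto simp: cover_diam_def)

lemma cover_diam_empty:
  assumes "\<U> \<noteq> {}"
  shows "cover_diam \<Phi> \<U> {} = 0"
proof -
  have "subordinate (\<Phi> t ` {}) \<U>" for t using assms by (auto simp: subordinate_def)
  then have "ereal (max s 0) \<le> cover_time \<Phi> \<U> {}" for s by (intro cover_time_ge) auto
  then have "cover_time \<Phi> \<U> {} = \<infinity>"
    by (intro ereal_top) (meson ereal_less_eq(3) max.cobounded1 order_trans)
  then show ?thesis by (simp add: cover_diam_def)
qed

lemma cover_measure_eq_SUP:
  "cover_measure \<Phi> \<U> \<alpha> Y =
    (SUP e\<in>{0<..}. INF E \<in> {E :: nat \<Rightarrow> 'a set. Y \<subseteq> (\<Union>i. E i) \<and> (\<forall>i. cover_diam \<Phi> \<U> (E i) < e)}.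
      cover_sum \<Phi> \<U> \<alpha> E)"
  unfolding cover_measure_def
  by (intro Lim_at_right_0_eq_SUP INF_superset_mono) (auto intro: less_le_trans)

lemma topological_entropy_nonneg:
  fixes f :: "'a::metric_space \<Rightarrow> 'a"
  assumes "compact (UNIV :: 'a set)" "continuous_on UNIV f"
  shows "0 \<le> topological_entropy f"
proof -
  have "0 \<le> ln (real m)" for m :: nat by (cases "m = 0") auto
  then have nn: "\<forall>n. (0::ereal) \<le> ereal (ln (real (spanning_number f n 1)) / real n)" by simp
  have "0 \<le> limsup (\<lambda>n. ereal (ln (real (spanning_number f n 1)) / real n))"
    by (rule le_Limsup) (use nn in \<open>auto intro: always_eventually\<close>)
  also have "\<dots> \<le> topological_entropy f"
    unfolding topological_entropy_eq_SUP[OF assms] by (rule SUP_upper) simp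
  finally show ?thesis .
qed

text \<open>Bowen balls of a spanning set form an admissible cover: if the radius is small against the
  Lebesgue number of \<open>\<U>\<close>, each of them stays subordinate to \<open>\<U>\<close> up to time \<open>n\<close>.\<close>

lemma cover_by_bowen_balls:
  fixes \<Phi> :: "real \<Rightarrow> 'a::metric_space \<Rightarrow> 'a"
  assumes cpt: "compact (UNIV :: 'a set)" and \<Phi>: "continuous_flow \<Phi>"
    and \<U>: "finite_open_cover \<U>" and h: "flow_entropy \<Phi> < ereal a" and "\<alpha> > 0"
  shows "\<forall>\<^sub>F n in sequentially. \<exists>E. (\<Union>i. E i) = UNIV \<and> (\<forall>i. cover_diam \<Phi> \<U> (E i) \<le> exp (- real n))
    \<and> cover_sum \<Phi> \<U> \<alpha> E \<le> ennreal (exp ((a - \<alpha>) * real n))"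
proof -
  have cont: "continuous_on UNIV (\<Phi> 1)" by (rule continuous_on_time_map[OF \<Phi>])
  obtain \<rho> where \<rho>: "\<rho> > 0" "\<And>x. \<exists>U\<in>\<U>. ball x \<rho> \<subseteq> U"
  proof (rule Heine_Borel_lemma[OF cpt, of \<U>])
    show "UNIV \<subseteq> \<Union>\<U>" "\<And>G. G \<in> \<U> \<Longrightarrow> open G" using \<U> by (auto simp: finite_open_cover_def)
  qed (auto intro: that)
  have "\<U> \<noteq> {}" using \<rho>(2) by auto
  obtain \<delta> where \<delta>: "\<delta> > 0"
    "\<And>t x y. \<bar>t\<bar> \<le> 1 \<Longrightarrow> dist x y < \<delta> \<Longrightarrow> dist (\<Phi> t x) (\<Phi> t y) < \<rho>"
    using flow_equicontinuous[OF cpt \<Phi> \<open>\<rho> > 0\<close>] by blast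
  have "\<forall>\<^sub>F n in sequentially. real (spanning_number (\<Phi> 1) n (\<delta> / 2)) < exp (a * real n)"
    using h \<delta>(1) unfolding flow_entropy_def
    by (intro entropy_less_imp_spanning_number_less[OF cpt cont]) auto
  then show ?thesis
  proof eventually_elim
    case (elim n)
    obtain C where C: "finite C" "spanning (\<Phi> 1) n (\<delta> / 2) C"
      "card C = spanning_number (\<Phi> 1) n (\<delta> / 2)"
      using spanning_number_attained[OF cpt cont, of "\<delta> / 2" n] \<delta>(1) by auto
    define B where "B y = {x. \<forall>i<n. dist ((\<Phi> 1 ^^ i) x) ((\<Phi> 1 ^^ i) y) \<le> \<delta> / 2}" for y
    have small: "cover_diam \<Phi> \<U> (B y) \<le> exp (- real n)" for y
    proof (intro cover_diam_le cover_time_ge)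
      fix t :: real assume t: "0 \<le> t" "t < real n"
      define i where "i = nat \<lfloor>t\<rfloor>"
      have i: "i < n" "\<bar>t - real i\<bar> \<le> 1" using t unfolding i_def by linarith+
      have "\<Phi> t ` B y \<subseteq> ball (\<Phi> t y) \<rho>"
      proof
        fix w assume "w \<in> \<Phi> t ` B y"
        then obtain x where x: "x \<in> B y" "w = \<Phi> t x" by blast
        have "dist (\<Phi> (real i) y) (\<Phi> (real i) x) \<le> \<delta> / 2"
          using x(1) i(1) by (auto simp: B_def funpow_time_one[OF \<Phi>] dist_commute)
        then have "dist (\<Phi> (t - real i) (\<Phi> (real i) y)) (\<Phi> (t - real i) (\<Phi> (real i) x)) < \<rho>"
          using i(2) \<delta>(1) by (intro \<delta>(2)) auto
        then show "w \<in> ball (\<Phi> t y) \<rho>" by (simp add: x(2) flip: flow_add[OF \<Phi>])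
      qed
      then show "subordinate (\<Phi> t ` B y) \<U>"
        unfolding subordinate_def using \<rho>(2) by (meson order_trans)
    qed simp
    obtain c where c: "bij_betw c {0..<card C} C" using ex_bij_betw_nat_finite[OF C(1)] by blast
    define E where "E i = (if i < card C then B (c i) else {})" for i
    have "(\<Union>i. E i) = UNIV"
    proof (intro equalityI subsetI UNIV_I)
      fix x
      obtain y where "y \<in> C" "x \<in> B y" using C(2) unfolding spanning_def B_def by blast
      moreover from \<open>y \<in> C\<close> have "y \<in> c ` {0..<card C}" using c by (simp add: bij_betw_def)
      then obtain i where "i < card C" "c i = y" by auto
      ultimately show "x \<in> (\<Union>i. E i)" by (intro UN_I[of i]) (auto simp: E_def)
    qed
    moreover have "cover_diam \<Phi> \<U> (E i) \<le> exp (- real n)" for i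
      using small by (simp add: E_def cover_diam_empty[OF \<open>\<U> \<noteq> {}\<close>])
    moreover have "cover_sum \<Phi> \<U> \<alpha> E \<le> ennreal (exp ((a - \<alpha>) * real n))"
    proof -
      have "cover_sum \<Phi> \<U> \<alpha> E = (\<Sum>i<card C. ennreal (cover_diam \<Phi> \<U> (E i) powr \<alpha>))"
        unfolding cover_sum_def
        by (rule suminf_finite) (auto simp: E_def cover_diam_empty[OF \<open>\<U> \<noteq> {}\<close>])
      also have "\<dots> \<le> (\<Sum>i<card C. ennreal (exp (- real n) powr \<alpha>))"
        using small \<open>\<alpha> > 0\<close>
        by (intro sum_mono ennreal_leI powr_mono2) (auto simp: E_def cover_diam_nonneg)
      also have "\<dots> = ennreal (real (card C) * exp (- \<alpha> * real n))"
        by (simp add: powr_def ennreal_of_nat_eq_real_of_nat ennreal_mult' mult.commute)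
      also have "\<dots> \<le> ennreal (exp (a * real n) * exp (- \<alpha> * real n))"
        using elim C(3) by (intro ennreal_leI mult_right_mono) auto
      also have "exp (a * real n) * exp (- \<alpha> * real n) = exp ((a - \<alpha>) * real n)"
        by (simp add: algebra_simps flip: exp_add)
      finally show ?thesis .
    qed
    ultimately show ?case by blast
  qed
qed

lemma subset_entropy_le_flow_entropy:
  fixes \<Phi> :: "real \<Rightarrow> 'a::metric_space \<Rightarrow> 'a"
  assumes cpt: "compact (UNIV :: 'a set)" and \<Phi>: "continuous_flow \<Phi>"
  shows "subset_entropy \<Phi> Y \<le> flow_entropy \<Phi>"
  unfolding subset_entropy_def
proof (rule SUP_least, rule ccontr)
  fix \<U> :: "'a set set" assume "\<U> \<in> {\<U>. finite_open_cover \<U>}" and "\<not> cover_entropy \<Phi> \<U> Y \<le> flow_entropy \<Phi>"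
  then have \<U>: "finite_open_cover \<U>" and "flow_entropy \<Phi> < cover_entropy \<Phi> \<U> Y" by auto
  then obtain \<alpha> where \<alpha>: "flow_entropy \<Phi> < ereal \<alpha>" "ereal \<alpha> < cover_entropy \<Phi> \<U> Y"
    using ereal_dense2 by blast
  obtain a where a: "flow_entropy \<Phi> < ereal a" "a < \<alpha>" using ereal_dense2[OF \<alpha>(1)] by auto
  have "0 \<le> flow_entropy \<Phi>" unfolding flow_entropy_def
    by (intro topological_entropy_nonneg cpt continuous_on_time_map \<Phi>)
  with \<alpha>(1) have "\<alpha> > 0" by (metis ereal_less(2) le_less_trans)
  have "(INF E \<in> {E :: nat \<Rightarrow> 'a set. Y \<subseteq> (\<Union>i. E i) \<and> (\<forall>i. cover_diam \<Phi> \<U> (E i) < e)}.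
      cover_sum \<Phi> \<U> \<alpha> E) \<le> ennreal 0" if "e > 0" for e
  proof (rule tendsto_lowerbound)
    have "(\<lambda>n. exp ((a - \<alpha>) * real n)) \<longlonglongrightarrow> 0"
      using a(2) by (intro filterlim_compose[OF exp_at_bot]
          filterlim_tendsto_neg_mult_at_bot[OF tendsto_const] filterlim_real_sequentially) auto
    then show "(\<lambda>n. ennreal (exp ((a - \<alpha>) * real n))) \<longlonglongrightarrow> ennreal 0" by (rule tendsto_ennrealI)
    have "(\<lambda>n. exp (- real n)) \<longlonglongrightarrow> 0"
      by (intro filterlim_compose[OF exp_at_bot]
          filterlim_compose[OF filterlim_uminus_at_bot_at_top] filterlim_real_sequentially)
    then have "\<forall>\<^sub>F n in sequentially. exp (- real n) < e" using \<open>e > 0\<close> by (rule order_tendstoD)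
    with cover_by_bowen_balls[OF cpt \<Phi> \<U> a(1) \<open>\<alpha> > 0\<close>]
    show "\<forall>\<^sub>F n in sequentially.
      (INF E \<in> {E :: nat \<Rightarrow> 'a set. Y \<subseteq> (\<Union>i. E i) \<and> (\<forall>i. cover_diam \<Phi> \<U> (E i) < e)}.
        cover_sum \<Phi> \<U> \<alpha> E) \<le> ennreal (exp ((a - \<alpha>) * real n))"
    proof eventually_elim
      case (elim n)
      then obtain E where "(\<Union>i. E i) = UNIV" "\<And>i. cover_diam \<Phi> \<U> (E i) \<le> exp (- real n)"
        "cover_sum \<Phi> \<U> \<alpha> E \<le> ennreal (exp ((a - \<alpha>) * real n))" by blast
      then show ?case using elim(2) by (intro INF_lower2[of E]) (auto intro: le_less_trans)
    qed
  qed simp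
  then have "cover_measure \<Phi> \<U> \<alpha> Y \<le> 0" unfolding cover_measure_eq_SUP by (intro SUP_least) auto
  then have "cover_measure \<Phi> \<U> \<alpha> Y = 0" by simp
  then have "cover_entropy \<Phi> \<U> Y \<le> ereal \<alpha>"
    unfolding cover_entropy_def using \<open>\<alpha> > 0\<close> by (intro Inf_lower) auto
  with \<alpha>(2) show False by simp
qed

text \<open>A mass distribution principle: Lebesgue measure on the parameters plays the role of the mass.
  A set \<open>B\<close> can contain the points \<open>z u\<close> only for parameters \<open>u\<close> from an interval whose length is
  at most a constant times \<open>D(B) powr \<alpha>\<close>.\<close>

lemma le_subset_entropy_of_separated_family:
  fixes \<Phi> :: "real \<Rightarrow> 'a::metric_space \<Rightarrow> 'a" and z :: "real \<Rightarrow> 'a"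
  assumes cpt: "compact (UNIV :: 'a set)" and \<Phi>: "continuous_flow \<Phi>" and "\<epsilon> > 0" "L > 0" "\<alpha> > 0"
    and zY: "\<And>u. u \<in> {0..<1} \<Longrightarrow> z u \<in> Y"
    and sep: "\<And>u u' l. u \<in> {0..<1} \<Longrightarrow> u' \<in> {0..<1} \<Longrightarrow>
      (\<And>i. i < l * L \<Longrightarrow> dist ((\<Phi> 1 ^^ i) (z u)) ((\<Phi> 1 ^^ i) (z u')) \<le> \<epsilon>) \<Longrightarrow>
      \<bar>u - u'\<bar> \<le> exp (- \<alpha> * real (l * L))"
  shows "ereal \<alpha> \<le> subset_entropy \<Phi> Y"
proof -
  obtain N where N: "finite N" "(UNIV :: 'a set) \<subseteq> (\<Union>x\<in>N. ball x (\<epsilon> / 2))"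
    using compactE_image[OF cpt, of UNIV "\<lambda>x. ball x (\<epsilon> / 2)"] \<open>\<epsilon> > 0\<close>
    by (metis UNIV_I UN_I centre_in_ball half_gt_zero open_ball subsetI)
  define \<U> where "\<U> = (\<lambda>x. ball x (\<epsilon> / 2)) ` N"
  have \<U>: "finite_open_cover \<U>" using N by (auto simp: finite_open_cover_def \<U>_def)
  have diam: "dist x y \<le> \<epsilon>" if "subordinate B \<U>" "x \<in> B" "y \<in> B" for B x y
  proof -
    obtain c where "B \<subseteq> ball c (\<epsilon> / 2)"
      using \<open>subordinate B \<U>\<close> unfolding subordinate_def \<U>_def by auto
    then have "x \<in> ball c (\<epsilon> / 2)" "y \<in> ball c (\<epsilon> / 2)" using that by auto
    then show ?thesis using dist_triangle3[of x y c] by (simp add: mem_ball)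
  qed
  define c where "c = exp (\<alpha> * real L)"
  have par: "\<bar>u - u'\<bar> \<le> c * cover_diam \<Phi> \<U> B powr \<alpha>"
    if u: "u \<in> {0..<1}" "u' \<in> {0..<1}" "z u \<in> B" "z u' \<in> B" for u u' B
  proof -
    have close: "\<bar>u - u'\<bar> \<le> exp (- \<alpha> * real (l * L))"
      if "ereal (real (l * L)) \<le> cover_time \<Phi> \<U> B" for l
    proof (rule sep[OF u(1,2)])
      fix i assume "i < l * L"
      then have "ereal (real i) < ereal (real (l * L))" by (simp only: less_ereal.simps of_nat_less_iff)
      then have "ereal (real i) < cover_time \<Phi> \<U> B" using that by (rule less_le_trans)
      then have "subordinate (\<Phi> (real i) ` B) \<U>" by (intro subordinate_before_cover_time) auto
      then show "dist ((\<Phi> 1 ^^ i) (z u)) ((\<Phi> 1 ^^ i) (z u')) \<le> \<epsilon>"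
        using u(3,4) unfolding funpow_time_one[OF \<Phi>] by (intro diam) auto
    qed
    show ?thesis
    proof (cases "cover_time \<Phi> \<U> B")
      case (real N)
      then have "N \<ge> 0" using cover_time_nonneg[of \<Phi> \<U> B] by simp
      define l where "l = nat \<lfloor>N / real L\<rfloor>"
      have fl: "real l \<le> N / real L" "N / real L \<le> real l + 1"
      proof -
        have "0 \<le> N / real L" using \<open>N \<ge> 0\<close> by simp
        then show "real l \<le> N / real L" "N / real L \<le> real l + 1" unfolding l_def by linarith+
      qed
      then have l: "real (l * L) \<le> N" "N \<le> real (l * L) + real L"
        using \<open>L > 0\<close> by (simp_all add: field_simps)
      have "\<bar>u - u'\<bar> \<le> exp (- \<alpha> * real (l * L))" using l(1) real by (intro close) simp
      also have "\<dots> \<le> exp (\<alpha> * real L + (- \<alpha> * N))"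
        using mult_left_mono[OF l(2), of \<alpha>] \<open>\<alpha> > 0\<close> by (simp add: algebra_simps)
      also have "\<dots> = c * cover_diam \<Phi> \<U> B powr \<alpha>"
        using real by (simp add: c_def cover_diam_def powr_def flip: exp_add)
      finally show ?thesis .
    next
      case PInf
      have "(\<lambda>l. exp (- \<alpha> * real L * real l)) \<longlonglongrightarrow> 0"
        using \<open>\<alpha> > 0\<close> \<open>L > 0\<close> by (intro filterlim_compose[OF exp_at_bot]
          filterlim_tendsto_neg_mult_at_bot[OF tendsto_const] filterlim_real_sequentially) auto
      moreover have "\<bar>u - u'\<bar> \<le> exp (- \<alpha> * real L * real l)" for l
        using close[of l] PInf by (simp add: mult_ac)
      ultimately have "\<bar>u - u'\<bar> \<le> 0" by (intro LIMSEQ_le_const) auto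
      then show ?thesis by (simp add: c_def)
    next
      case MInf
      then show ?thesis using cover_time_nonneg[of \<Phi> \<U> B] by simp
    qed
  qed
  have lower: "ennreal (1 / (2 * c)) \<le> cover_sum \<Phi> \<U> \<beta> E"
    if cov: "Y \<subseteq> (\<Union>i. E i)" and \<beta>: "0 < \<beta>" "\<beta> \<le> \<alpha>" for E \<beta>
  proof -
    define r where "r i = c * cover_diam \<Phi> \<U> (E i) powr \<alpha>" for i
    have r0: "r i \<ge> 0" for i by (simp add: r_def c_def)
    define P where "P i = {u\<in>{0..<1}. z u \<in> E i}" for i
    define J where "J i = (if P i = {} then {} else {(SOME u. u \<in> P i) - r i..(SOME u. u \<in> P i) + r i})" for i
    have PJ: "P i \<subseteq> J i" for i
    proof
      fix u assume u: "u \<in> P i"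
      then have "(SOME u. u \<in> P i) \<in> P i" by (rule someI)
      then have "\<bar>u - (SOME u. u \<in> P i)\<bar> \<le> r i" using u par unfolding P_def r_def by blast
      then show "u \<in> J i" using u by (auto simp: J_def abs_le_iff)
    qed
    have "{0..<1} \<subseteq> (\<Union>i. J i)"
    proof
      fix u :: real assume u: "u \<in> {0..<1}"
      then obtain i where "z u \<in> E i" using zY cov by blast
      then have "u \<in> P i" using u by (simp add: P_def)
      then show "u \<in> (\<Union>i. J i)" using PJ by blast
    qed
    then have "emeasure lborel {0..<1::real} \<le> emeasure lborel (\<Union>i. J i)"
      by (intro emeasure_mono) (auto simp: J_def)
    also have "\<dots> \<le> (\<Sum>i. emeasure lborel (J i))"
      by (rule emeasure_subadditive_countably) (auto simp: J_def)
    also have "\<dots> \<le> (\<Sum>i. ennreal (2 * c) * ennreal (cover_diam \<Phi> \<U> (E i) powr \<beta>))"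
    proof (intro suminf_le summableI)
      fix i
      have "emeasure lborel (J i) \<le> ennreal (2 * r i)"
        using r0[of i] by (auto simp: J_def)
      also have "\<dots> \<le> ennreal (2 * (c * cover_diam \<Phi> \<U> (E i) powr \<beta>))"
        using \<beta> cover_diam_nonneg cover_diam_le_1 unfolding r_def
        by (intro ennreal_leI mult_left_mono powr_mono') (auto simp: c_def)
      finally show "emeasure lborel (J i) \<le> ennreal (2 * c) * ennreal (cover_diam \<Phi> \<U> (E i) powr \<beta>)"
        by (simp add: c_def mult_ac flip: ennreal_mult')
    qed
    also have "\<dots> = ennreal (2 * c) * cover_sum \<Phi> \<U> \<beta> E" by (simp add: cover_sum_def)
    finally have 1: "1 \<le> ennreal (2 * c) * cover_sum \<Phi> \<U> \<beta> E" by simp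
    have "ennreal (1 / (2 * c)) * 1 \<le> ennreal (1 / (2 * c)) * (ennreal (2 * c) * cover_sum \<Phi> \<U> \<beta> E)"
      by (intro mult_left_mono 1) simp
    also have "\<dots> = cover_sum \<Phi> \<U> \<beta> E"
      unfolding mult.assoc[symmetric] by (simp add: c_def flip: ennreal_mult')
    finally show ?thesis by simp
  qed
  have "cover_measure \<Phi> \<U> \<beta> Y \<noteq> 0" if "0 < \<beta>" "\<beta> \<le> \<alpha>" for \<beta>
  proof -
    have "ennreal (1 / (2 * c)) \<le> (INF E \<in> {E. Y \<subseteq> (\<Union>i. E i) \<and> (\<forall>i. cover_diam \<Phi> \<U> (E i) < 1)}.
        cover_sum \<Phi> \<U> \<beta> E)"
      using lower that by (intro INF_greatest) auto
    also have "\<dots> \<le> cover_measure \<Phi> \<U> \<beta> Y"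
      unfolding cover_measure_eq_SUP by (rule SUP_upper) simp
    finally have "ennreal (1 / (2 * c)) \<le> cover_measure \<Phi> \<U> \<beta> Y" .
    moreover have "0 < ennreal (1 / (2 * c))" by (simp add: c_def)
    ultimately show ?thesis by (metis not_le)
  qed
  then have "ereal \<alpha> \<le> cover_entropy \<Phi> \<U> Y"
    unfolding cover_entropy_def by (intro Inf_greatest) (auto simp: not_less intro: ccontr)
  also have "\<dots> \<le> subset_entropy \<Phi> Y"
    unfolding subset_entropy_def using \<U> by (intro SUP_upper) auto
  finally show ?thesis .
qed

lemma subset_entropy_nonneg: "0 \<le> subset_entropy \<Phi> Y"
proof -
  have "0 \<le> cover_entropy \<Phi> {UNIV} Y"
    unfolding cover_entropy_def by (intro Inf_greatest) auto
  also have "\<dots> \<le> subset_entropy \<Phi> Y"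
    unfolding subset_entropy_def by (intro SUP_upper) (auto simp: finite_open_cover_def)
  finally show ?thesis .
qed

section \<open>A large family of irregular points\<close>

text \<open>The constants are chosen in the order \<open>\<rho>\<close>, \<open>\<eta>\<close>, \<open>\<gamma>\<close>, \<open>\<epsilon>\<close>, \<open>n\<close>, \<open>r\<close>. The proportion \<open>\<rho>\<close> of time given to the
  competing segments must be so small that \<open>M\<close> choices in \<open>n + r\<close> steps still amount to the entropy \<open>\<alpha>\<close>. The
  oscillation that these segments cause is about \<open>\<rho> * G\<close> per step, and \<open>\<eta>\<close>, the error allowed in
  all averages, must be small against it.\<close>

lemma irregular_family:
  fixes f :: "'a::metric_space \<Rightarrow> 'a"
  assumes cpt: "compact (UNIV :: 'a set)" and f: "continuous_on UNIV f" and tracing: "sparse_tracing f"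
    and \<psi>: "continuous_on UNIV \<psi>"
    and div: "\<not> convergent (\<lambda>n. birkhoff_sum f \<psi> n x / real n)"
    and \<alpha>: "0 < \<alpha>" "ereal \<alpha> < topological_entropy f"
  obtains \<epsilon> L z where "\<epsilon> > 0" "L > 0"
    "\<And>u. u \<in> {0..<1} \<Longrightarrow> \<not> convergent (\<lambda>n. birkhoff_sum f \<psi> n (z u) / real n)"
    "\<And>u u' l. u \<in> {0..<1} \<Longrightarrow> u' \<in> {0..<1} \<Longrightarrow>
      (\<And>i. i < l * L \<Longrightarrow> dist ((f ^^ i) (z u)) ((f ^^ i) (z u')) \<le> \<epsilon>) \<Longrightarrow>
      \<bar>u - u'\<bar> \<le> exp (- \<alpha> * real (l * L))"
proof -
  have "bounded (range \<psi>)" using cpt \<psi> by (intro compact_imp_bounded compact_continuous_image)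
  then obtain K where "K > 0" and K: "\<And>x. \<bar>\<psi> x\<bar> \<le> K" by (auto simp: bounded_pos)
  obtain G where G: "G > 0"
    "\<And>r. r > 0 \<Longrightarrow> \<exists>y y'. birkhoff_sum f \<psi> r y - birkhoff_sum f \<psi> r y' \<ge> G * real r"
    using gap_of_divergent_averages[OF K less_imp_le[OF \<open>K > 0\<close>] div] by blast
  obtain e \<kappa> h where e: "e > 0" "\<kappa> > 0" "h > \<alpha>" and rich:
    "\<And>\<eta>. \<eta> > 0 \<Longrightarrow> \<exists>\<^sub>F n in sequentially. \<exists>P. finite P \<and> exp (h * real n) \<le> real (card P) \<and>
      (\<forall>p\<in>P. \<forall>q\<in>P. p \<noteq> q \<longrightarrow> \<kappa> * real n < real (mismatch f e n p q)) \<and>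
      (\<forall>p\<in>P. \<forall>q\<in>P. \<bar>birkhoff_sum f \<psi> n p - birkhoff_sum f \<psi> n q\<bar> \<le> \<eta> * real n)"
    by (rule rich_separated_sets[where \<psi> = \<psi>, OF cpt f K less_imp_le[OF \<alpha>(1)] \<alpha>(2)]) blast
  \<comment> \<open>with \<open>r \<le> 2 * \<rho> * n\<close> this gives \<open>\<alpha> * (n + r) \<le> h * n\<close>\<close>
  define \<rho> where "\<rho> = min 1 ((h - \<alpha>) / (2 * \<alpha>))"
  have \<rho>: "0 < \<rho>" "\<rho> \<le> 1" "\<rho> \<le> (h - \<alpha>) / (2 * \<alpha>)" using e \<alpha> by (auto simp: \<rho>_def)
  then have \<rho>h: "\<alpha> + 2 * \<alpha> * \<rho> \<le> h" using \<alpha> by (simp add: field_simps)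
  define \<eta> where "\<eta> = \<rho> * G / 12"
  have "\<eta> > 0" using \<rho> G by (simp add: \<eta>_def)
  \<comment> \<open>the first bound makes the digits recoverable from the traced orbit: both
    mismatch counts together do not exceed \<open>\<kappa> * n\<close>; the second controls the Birkhoff sums\<close>
  define \<gamma> where "\<gamma> = min (\<kappa> / 2) (\<eta> / (2 * K))"
  have "\<gamma> > 0" using e \<open>\<eta> > 0\<close> \<open>K > 0\<close> by (simp add: \<gamma>_def)
  have \<gamma>: "2 * \<gamma> \<le> \<kappa>" "\<gamma> \<le> \<eta> / (2 * K)" by (auto simp: \<gamma>_def)
  then have \<gamma>K: "\<eta> + 2 * K * \<gamma> \<le> 2 * \<eta>" using \<open>K > 0\<close> by (simp add: field_simps)
  have "uniformly_continuous_on UNIV \<psi>" using \<psi> cpt by (rule compact_uniformly_continuous)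
  then obtain \<epsilon>1 where \<epsilon>1: "\<epsilon>1 > 0" "\<And>x y. dist x y < \<epsilon>1 \<Longrightarrow> dist (\<psi> x) (\<psi> y) < \<eta>"
    unfolding uniformly_continuous_on_def using \<open>\<eta> > 0\<close> by (metis UNIV_I)
  \<comment> \<open>two tracing errors and the distance of the two orbits add up to at most \<open>e\<close>\<close>
  define \<epsilon> where "\<epsilon> = min (e / 3) (\<epsilon>1 / 2)"
  have "\<epsilon> > 0" and \<epsilon>e: "3 * \<epsilon> \<le> e" using e \<epsilon>1 by (auto simp: \<epsilon>_def)
  have osc: "\<bar>\<psi> x - \<psi> y\<bar> \<le> \<eta>" if "dist x y \<le> \<epsilon>" for x y
    using \<epsilon>1(2)[of x y] that \<epsilon>1(1) by (auto simp: \<epsilon>_def dist_real_def)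
  obtain n0 where n0: "\<And>l x. (\<And>j::nat. n0 \<le> l j) \<Longrightarrow> \<exists>z. \<forall>j.
      real (mismatch f \<epsilon> (l j) ((f ^^ (\<Sum>i<j. l i)) z) (x j)) \<le> \<gamma> * real (l j)"
    using tracing \<open>\<epsilon> > 0\<close> \<open>\<gamma> > 0\<close> unfolding sparse_tracing_def by metis
  \<comment> \<open>makes \<open>\<rho> * n\<close>, hence also \<open>r\<close>, exceed the tracing threshold \<open>n0\<close>\<close>
  obtain n1 :: nat where n1: "(real n0 + 1) / \<rho> \<le> real n1" using real_arch_simple by blast
  obtain n P where "n \<ge> max n0 n1" and P: "finite P" "exp (h * real n) \<le> real (card P)"
      "\<And>p q. p \<in> P \<Longrightarrow> q \<in> P \<Longrightarrow> p \<noteq> q \<Longrightarrow> \<kappa> * real n < real (mismatch f e n p q)"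
      "\<And>p q. p \<in> P \<Longrightarrow> q \<in> P \<Longrightarrow> \<bar>birkhoff_sum f \<psi> n p - birkhoff_sum f \<psi> n q\<bar> \<le> \<eta> * real n"
    using rich[OF \<open>\<eta> > 0\<close>] unfolding frequently_sequentially by meson
  then have n: "n \<ge> n0" "n \<ge> n1" by auto
  have "(real n0 + 1) / \<rho> \<le> real n" using n1 n(2) by linarith
  then have \<rho>n: "real n0 + 1 \<le> \<rho> * real n" using \<rho>(1) by (simp add: field_simps)
  define r where "r = nat \<lceil>\<rho> * real n\<rceil>"
  have r: "\<rho> * real n \<le> real r" "real r \<le> 2 * (\<rho> * real n)" "n0 \<le> r" "0 < r"
    using \<rho>n unfolding r_def by linarith+
  define L where "L = r + n"
  obtain yp ym where y: "birkhoff_sum f \<psi> r yp - birkhoff_sum f \<psi> r ym \<ge> G * real r"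
    using G(2)[OF r(4)] by blast
  define M where "M = card P"
  have "\<alpha> * real L \<le> (\<alpha> + 2 * \<alpha> * \<rho>) * real n"
    using mult_left_mono[OF r(2), of \<alpha>] \<alpha>(1) by (simp add: L_def algebra_simps)
  also have "\<dots> \<le> h * real n" using \<rho>h by (intro mult_right_mono) auto
  finally have "exp (\<alpha> * real L) \<le> exp (h * real n)" by simp
  then have M: "exp (\<alpha> * real L) \<le> real M" using P(2) unfolding M_def by (rule order_trans)
  then have "M > 0" using exp_gt_zero[of "\<alpha> * real L"] by (intro gr0I) auto
  obtain p where p: "bij_betw p {0..<M} P"
    using ex_bij_betw_nat_finite[OF P(1)] unfolding M_def by blast
  have pP: "p i \<in> P" if "i < M" for i using p that by (auto simp: bij_betw_def)
  \<comment> \<open>segments with an even index compete, those with an odd index carry the digits\<close>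
  define up where "up s \<longleftrightarrow> even (nat \<lfloor>log 2 (real s)\<rfloor>)" for s :: nat
  define seg where "seg u j = (if even j then if up (j div 2) then yp else ym
      else p (digit M u (j div 2)))" for u j
  define len where "len j = (if even j then r else n)" for j :: nat
  have "\<exists>z. \<forall>j. real (mismatch f \<epsilon> (len j) ((f ^^ (\<Sum>i<j. len i)) z) (seg u j)) \<le> \<gamma> * real (len j)" for u
    using r(3) n(1) by (intro n0) (simp add: len_def)
  then obtain z where z: "\<And>u j.
      real (mismatch f \<epsilon> (len j) ((f ^^ (\<Sum>i<j. len i)) (z u)) (seg u j)) \<le> \<gamma> * real (len j)"
    by metis
  have len: "len (2 * s) = r" "len (Suc (2 * s)) = n" for s by (simp_all add: len_def)
  have sum_len: "(\<Sum>i<2 * s. len i) = s * L" for s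
    by (induction s) (simp_all add: len L_def)
  have zA: "real (mismatch f \<epsilon> r ((f ^^ (s * L)) (z u)) (if up s then yp else ym)) \<le> \<gamma> * real r" for u s
    using z[of "2 * s" u] by (simp add: sum_len len seg_def)
  have zB: "real (mismatch f \<epsilon> n ((f ^^ (s * L + r)) (z u)) (p (digit M u s))) \<le> \<gamma> * real n" for u s
    using z[of "Suc (2 * s)" u] by (simp add: sum_len len seg_def)
  have irregular: "\<not> convergent (\<lambda>n. birkhoff_sum f \<psi> n (z u) / real n)" for u
  proof
    assume "convergent (\<lambda>n. birkhoff_sum f \<psi> n (z u) / real n)"
    then obtain c where c: "(\<lambda>n. birkhoff_sum f \<psi> n (z u) / real n) \<longlonglongrightarrow> c" by (auto simp: convergent_def)
    define v where "v s = birkhoff_sum f \<psi> L ((f ^^ (s * L)) (z u))" for s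
    have "L > 0" using r(4) by (simp add: L_def)
    have "(\<lambda>q. birkhoff_sum f \<psi> (q * L) (z u) / real (q * L)) \<longlonglongrightarrow> c"
      using LIMSEQ_subseq_LIMSEQ[OF c, of "\<lambda>q. q * L"] \<open>L > 0\<close> by (simp add: strict_mono_def o_def)
    then have "(\<lambda>q. real L * (birkhoff_sum f \<psi> (q * L) (z u) / real (q * L))) \<longlonglongrightarrow> real L * c"
      by (intro tendsto_mult tendsto_const)
    moreover have "real L * (birkhoff_sum f \<psi> (q * L) (z u) / real (q * L)) = (\<Sum>s<q. v s) / real q" for q
      using \<open>L > 0\<close> unfolding v_def birkhoff_sum_mult[symmetric] by simp
    ultimately have "convergent (\<lambda>q. (\<Sum>s<q. v s) / real q)" by (auto simp: convergent_def)
    define b where "b = birkhoff_sum f \<psi> n (p 0)"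
    \<comment> \<open>tracing costs \<open>2 * \<eta>\<close> per step, and comparing the digit segment with \<open>p 0\<close> another \<open>\<eta>\<close>\<close>
    define err where "err = 2 * \<eta> * real r + 3 * \<eta> * real n"
    have v: "\<bar>v s - (birkhoff_sum f \<psi> r (if up s then yp else ym) + b)\<bar> \<le> err" for s
    proof -
      have "\<bar>birkhoff_sum f \<psi> r ((f ^^ (s * L)) (z u)) - birkhoff_sum f \<psi> r (if up s then yp else ym)\<bar>
          \<le> (\<eta> + 2 * K * \<gamma>) * real r"
        using birkhoff_sum_diff_le_mismatch[OF osc K zA] \<open>\<eta> > 0\<close> \<open>K > 0\<close> by simp
      also have "\<dots> \<le> 2 * \<eta> * real r" using \<gamma>K by (intro mult_right_mono) auto
      finally have 1: "\<bar>birkhoff_sum f \<psi> r ((f ^^ (s * L)) (z u)) - birkhoff_sum f \<psi> r (if up s then yp else ym)\<bar>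
          \<le> 2 * \<eta> * real r" .
      have "\<bar>birkhoff_sum f \<psi> n ((f ^^ (s * L + r)) (z u)) - birkhoff_sum f \<psi> n (p (digit M u s))\<bar>
          \<le> (\<eta> + 2 * K * \<gamma>) * real n"
        using birkhoff_sum_diff_le_mismatch[OF osc K zB] \<open>\<eta> > 0\<close> \<open>K > 0\<close> by simp
      also have "\<dots> \<le> 2 * \<eta> * real n" using \<gamma>K by (intro mult_right_mono) auto
      finally have 2: "\<bar>birkhoff_sum f \<psi> n ((f ^^ (s * L + r)) (z u)) - birkhoff_sum f \<psi> n (p (digit M u s))\<bar>
          \<le> 2 * \<eta> * real n" .
      have 3: "\<bar>birkhoff_sum f \<psi> n (p (digit M u s)) - b\<bar> \<le> \<eta> * real n"
        unfolding b_def using \<open>M > 0\<close> by (intro P pP digit_less)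
      have "v s = birkhoff_sum f \<psi> r ((f ^^ (s * L)) (z u)) + birkhoff_sum f \<psi> n ((f ^^ (s * L + r)) (z u))"
        unfolding v_def L_def birkhoff_sum_add by (simp add: funpow_add add.commute)
      then show ?thesis using 1 2 3 unfolding err_def by linarith
    qed
    have up: "up s \<longleftrightarrow> even k" if "2 ^ k \<le> s" "s < 2 ^ (k + 1)" for k s
    proof -
      have "s > 0" using that(1) by (intro gr0I) auto
      then have "\<lfloor>log (real 2) (real s)\<rfloor> = int k"
        using that floor_log_nat_eq_powr_iff[of 2 s k] by auto
      then show ?thesis by (simp add: up_def)
    qed
    have "\<eta> * real n \<le> G / 12 * real r"
      using mult_left_mono[OF r(1), of "G / 12"] G(1) by (simp add: \<eta>_def mult_ac)
    moreover have "\<eta> * real r \<le> G / 12 * real r"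
      using \<rho>(2) G(1) by (intro mult_right_mono) (auto simp: \<eta>_def)
    moreover have "0 < G * real r" using G(1) r(4) by simp
    ultimately have gap: "birkhoff_sum f \<psi> r ym + b + err < birkhoff_sum f \<psi> r yp + b - err"
      using y unfolding err_def by (simp add: algebra_simps)
    have "\<not> convergent (\<lambda>q. (\<Sum>s<q. v s) / real q)"
    proof (rule divergent_of_dyadic_oscillation[OF _ _ gap])
      fix k s :: nat assume k: "2 ^ k \<le> s" "s < 2 ^ (k + 1)"
      show "birkhoff_sum f \<psi> r yp + b - err \<le> v s" if "even k"
        using v[of s] up[OF k] that by simp
      show "v s \<le> birkhoff_sum f \<psi> r ym + b + err" if "odd k"
        using v[of s] up[OF k] that by simp
    qed
    then show False using \<open>convergent (\<lambda>q. (\<Sum>s<q. v s) / real q)\<close> by blast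
  qed
  have separated: "\<bar>u - u'\<bar> \<le> exp (- \<alpha> * real (l * L))"
    if u: "u \<in> {0..<1}" "u' \<in> {0..<1}"
      and close: "\<And>i. i < l * L \<Longrightarrow> dist ((f ^^ i) (z u)) ((f ^^ i) (z u')) \<le> \<epsilon>" for u u' l
  proof -
    have "digit M u s = digit M u' s" if "s < l" for s
    proof -
      define q q' where "q = p (digit M u s)" and "q' = p (digit M u' s)"
      have "Suc s * L \<le> l * L" using that by (intro mult_right_mono) auto
      then have "s * L + r + n \<le> l * L" by (simp add: L_def)
      then have "mismatch f \<epsilon> n ((f ^^ (s * L + r)) (z u)) ((f ^^ (s * L + r)) (z u')) = 0"
        using close[of "_ + (s * L + r)"] by (simp add: mismatch_eq_0_iff funpow_add)
      moreover have "mismatch f (\<epsilon> + (\<epsilon> + \<epsilon>)) n q q' \<le> mismatch f \<epsilon> n q ((f ^^ (s * L + r)) (z u)) +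
          (mismatch f \<epsilon> n ((f ^^ (s * L + r)) (z u)) ((f ^^ (s * L + r)) (z u'))
            + mismatch f \<epsilon> n ((f ^^ (s * L + r)) (z u')) q')"
        by (meson add_left_mono mismatch_triangle order_trans)
      moreover have "mismatch f e n q q' \<le> mismatch f (\<epsilon> + (\<epsilon> + \<epsilon>)) n q q'"
        using \<epsilon>e by (intro mismatch_antimono) simp
      ultimately have "real (mismatch f e n q q') \<le> \<gamma> * real n + \<gamma> * real n"
        using zB[of s u] zB[of s u'] unfolding q_def q'_def mismatch_commute[of f \<epsilon> n "p _"] by linarith
      also have "\<dots> \<le> \<kappa> * real n"
        using mult_right_mono[OF \<gamma>(1), of "real n"] by simp
      finally have "q = q'"
        using P(3)[of q q'] pP digit_less[OF \<open>M > 0\<close>] unfolding q_def q'_def by force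
      then show ?thesis
        using p digit_less[OF \<open>M > 0\<close>] unfolding q_def q'_def bij_betw_def inj_on_def by auto
    qed
    then have "\<bar>u - u'\<bar> \<le> 1 / real M ^ l" by (rule close_of_digits_eq[OF \<open>M > 0\<close> u])
    also have "\<dots> \<le> 1 / exp (\<alpha> * real L) ^ l"
      using M \<open>M > 0\<close> by (intro divide_left_mono power_mono mult_pos_pos) auto
    also have "\<dots> = exp (- \<alpha> * real (l * L))"
      by (simp add: exp_minus field_simps flip: exp_of_nat_mult)
    finally show ?thesis .
  qed
  show ?thesis using that[of \<epsilon> L z] \<open>\<epsilon> > 0\<close> r(4) irregular separated by (simp add: L_def)
qed

theorem theorem5p18:
  fixes \<Phi> :: "real \<Rightarrow> 'a::metric_space \<Rightarrow> 'a"
    and \<phi> :: "'a \<Rightarrow> real"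
  assumes "compact (UNIV :: 'a set)"
    and "continuous_flow \<Phi>"
    and "almost_specification \<Phi>"
    and "continuous_on UNIV \<phi>"
    and "irregular_points \<Phi> \<phi> \<noteq> {}"
  shows "subset_entropy \<Phi> (irregular_points \<Phi> \<phi>) = flow_entropy \<Phi>"
proof (rule antisym)
  show "subset_entropy \<Phi> (irregular_points \<Phi> \<phi>) \<le> flow_entropy \<Phi>"
    by (rule subset_entropy_le_flow_entropy[OF assms(1,2)])
  show "flow_entropy \<Phi> \<le> subset_entropy \<Phi> (irregular_points \<Phi> \<phi>)"
  proof (rule ccontr)
    assume "\<not> ?thesis"
    then obtain \<alpha> where \<alpha>: "subset_entropy \<Phi> (irregular_points \<Phi> \<phi>) < ereal \<alpha>"
      "ereal \<alpha> < flow_entropy \<Phi>"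
      using ereal_dense2 by (metis not_le)
    have "\<alpha> > 0" using le_less_trans[OF subset_entropy_nonneg \<alpha>(1)] by simp
    note irr = irregular_points_iff_time_one[OF assms(1,2,4)]
    obtain x where x: "\<not> convergent (\<lambda>n. birkhoff_sum (\<Phi> 1) (unit_integral \<Phi> \<phi>) n x / real n)"
      using assms(5) irr by blast
    obtain \<epsilon> L z where fam: "\<epsilon> > 0" "L > 0"
      "\<And>u. u \<in> {0..<1} \<Longrightarrow> \<not> convergent (\<lambda>n. birkhoff_sum (\<Phi> 1) (unit_integral \<Phi> \<phi>) n (z u) / real n)"
      "\<And>u u' l. u \<in> {0..<1} \<Longrightarrow> u' \<in> {0..<1} \<Longrightarrow>
        (\<And>i. i < l * L \<Longrightarrow> dist ((\<Phi> 1 ^^ i) (z u)) ((\<Phi> 1 ^^ i) (z u')) \<le> \<epsilon>) \<Longrightarrow>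
        \<bar>u - u'\<bar> \<le> exp (- \<alpha> * real (l * L))"
      using irregular_family[OF assms(1) continuous_on_time_map[OF assms(2)]
          sparse_tracing_time_one[OF assms(1-3)] continuous_on_unit_integral[OF assms(2,4)]
          x \<open>\<alpha> > 0\<close> \<alpha>(2)[unfolded flow_entropy_def]] by blast
    have "ereal \<alpha> \<le> subset_entropy \<Phi> (irregular_points \<Phi> \<phi>)"
      using fam(3) irr
      by (intro le_subset_entropy_of_separated_family[OF assms(1,2) fam(1,2) \<open>\<alpha> > 0\<close> _ fam(4)]) auto
    with \<alpha>(1) show False by simp
  qed
qed

end
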